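(* Let $d\ge 1$. There exists a set $E\subset\mathbb{R}^d$ with $\mathcal{L}^d(E)=0$ such that for every $\boldsymbol{\theta}=(\theta_1,\ldots,\theta_d)\in\mathbb{R}^d\setminus E$ with $\min_j|\theta_j|>1$, for every finite digit set $\mathcal{D}=\{a_1,\ldots,a_m\}\subset\mathbb{R}^d$ (any $m\ge 2$) such that the iterated function system $\{x\mapsto Ax+a_j\}_{j=1}^m$ with $A=\mathrm{Diag}[\theta_1^{-1},\ldots,\theta_d^{-1}]$ is affinely irreducible, and for every probability vector $\boldsymbol{p}=(p_1,\ldots,p_m)$ with all $p_j>0$, the self-affine measure $\mu(\boldsymbol{\theta},\mathcal{D},\boldsymbol{p})$ has power Fourier decay, i.e. $\mu(\boldsymbol{\theta},\mathcal{D},\boldsymbol{p})\in\mathscr{D}_d$.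
   Context: $\mathcal{L}^d$ is Lebesgue measure on $\mathbb{R}^d$. For a finite positive Borel measure $\nu$ on $\mathbb{R}^d$, $\widehat{\nu}(\xi)=\int_{\mathbb{R}^d}e^{-2\pi i\langle\xi,x\rangle}\,d\nu(x)$. For $\alpha>0$, $\mathscr{D}_d(\alpha)$ is the set of finite positive Borel measures $\nu$ on $\mathbb{R}^d$ such that $|\widehat{\nu}(t)|=O_\nu(|t|^{-\alpha})$ as $|t|\to\infty$ (the implied constant may depend on $\nu$), and $\mathscr{D}_d=\bigcup_{\alpha>0}\mathscr{D}_d(\alpha)$; a measure has power Fourier decay if it belongs to $\mathscr{D}_d$. For $\boldsymbol{\theta}=(\theta_1,\ldots,\theta_d)$ with real entries $|\theta_j|>1$, put $A=\mathrm{Diag}[\theta_1^{-1},\ldots,\theta_d^{-1}]$. For a digit set $\mathcal{D}=\{a_1,\ldots,a_m\}\subset\mathbb{R}^d$, $m\ge2$, and a probability vector $\boldsymbol{p}=(p_1,\ldots,p_m)$, the self-affine measure $\mu=\mu(\boldsymbol{\theta},\mathcal{D},\boldsymbol{p})$ is the unique Borel probability measure on $\mathbb{R}^d$ satisfying $\mu=\sum_{j=1}^m p_j\,(\mu\circ f_j^{-1})$, where $f_j(x)=Ax+a_j$. The iterated function system $\{f_j\}_{j=1}^m$ is affinely irreducible if its attractor $K_{A,\mathcal{D}}=\{\sum_{n=0}^\infty A^n b_n:\ b_n\in\mathcal{D}\}$ is not contained in a proper affine subspace of $\mathbb{R}^d$. *)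

theory Defs
  imports "HOL-Probability.Probability" "HOL-Library.Landau_Symbols"
begin

definition fourier :: "'a::euclidean_space measure \<Rightarrow> 'a \<Rightarrow> complex" where
  "fourier \<nu> \<xi> = (CLINT x|\<nu>. exp (- 2 * complex_of_real pi * \<i> * complex_of_real (\<xi> \<bullet> x)))"

definition fourier_decay_of_order :: "real \<Rightarrow> 'a::euclidean_space measure set" where
  "fourier_decay_of_order \<alpha> =
     {\<nu>. sets \<nu> = sets borel \<and> finite_measure \<nu> \<and>
          (\<lambda>t. norm (fourier \<nu> t)) \<in> O[at_infinity](\<lambda>t. norm t powr (- \<alpha>))}"

definition power_fourier_decay :: "'a::euclidean_space measure set" where
  "power_fourier_decay = (\<Union>\<alpha>\<in>{0<..}. fourier_decay_of_order \<alpha>)"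

definition contraction_matrix :: "real ^ 'n \<Rightarrow> real ^ 'n ^ 'n" where
  "contraction_matrix \<theta> = (\<chi> i j. if i = j then inverse (\<theta> $ i) else 0)"

definition ifs_map :: "real ^ 'n \<Rightarrow> real ^ 'n \<Rightarrow> real ^ 'n \<Rightarrow> real ^ 'n" where
  "ifs_map \<theta> b x = contraction_matrix \<theta> *v x + b"

definition is_self_affine_measure ::
  "real ^ 'n \<Rightarrow> nat \<Rightarrow> (nat \<Rightarrow> real ^ 'n) \<Rightarrow> (nat \<Rightarrow> real) \<Rightarrow> (real ^ 'n) measure \<Rightarrow> bool" where
  "is_self_affine_measure \<theta> m a p \<mu> \<longleftrightarrow>
     sets \<mu> = sets borel \<and> prob_space \<mu> \<and>
     (\<forall>B\<in>sets borel. measure \<mu> B = (\<Sum>j=1..m. p j * measure \<mu> (ifs_map \<theta> (a j) -` B)))"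

(* Exactly one such measure exists (Hutchinson) when all entries of theta exceed 1 in
   absolute value and p is a probability vector on {1..m}; otherwise the value is irrelevant.
   Only the values of a and p on {1..m} matter. *)
definition self_affine_measure ::
  "real ^ 'n \<Rightarrow> nat \<Rightarrow> (nat \<Rightarrow> real ^ 'n) \<Rightarrow> (nat \<Rightarrow> real) \<Rightarrow> (real ^ 'n) measure" where
  "self_affine_measure \<theta> m a p = (THE \<mu>. is_self_affine_measure \<theta> m a p \<mu>)"

(* A^n is the n-fold iterate of x |-> A x; the library's power on real^'n^'n would be
   taken entrywise. *)
definition attractor :: "real ^ 'n \<Rightarrow> (real ^ 'n) set \<Rightarrow> (real ^ 'n) set" where
  "attractor \<theta> D =
     {(\<Sum>n. ((\<lambda>x. contraction_matrix \<theta> *v x) ^^ n) (b n)) | b. \<forall>n::nat. b n \<in> D}"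

definition affinely_irreducible :: "real ^ 'n \<Rightarrow> (real ^ 'n) set \<Rightarrow> bool" where
  "affinely_irreducible \<theta> D \<longleftrightarrow> \<not> (\<exists>S. affine S \<and> S \<noteq> UNIV \<and> attractor \<theta> D \<subseteq> S)"

end

theory Submission
  imports Defs
begin

text \<open>
  Let \<open>P(\<xi>)\<close> be the Fourier transform of the discrete measure that gives mass \<open>p\<^sub>j\<close> to the digit
  \<open>a\<^sub>j\<close>. Self-affinity means \<open>\<mu>^(\<xi>) = P(\<xi>) \<mu>^(A \<xi>)\<close>, hence
  \<open>\<bar>\<mu>^(\<xi>)\<bar> \<le> \<bar>P(\<xi>)\<bar> \<bar>P(A \<xi>)\<bar> \<cdots> \<bar>P(A\<^sup>N \<xi>)\<bar>\<close>. Every factor is at most 1, and a factor is at most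
  some constant \<open>\<tau> < 1\<close> as soon as the phase \<open>\<langle>A\<^sup>l \<xi>, a\<^sub>j - a\<^sub>1\<rangle>\<close> of some digit stays away from the integers.
  If \<open>N\<close> is the first time at which all coordinates of \<open>A\<^sup>N \<xi>\<close> are at most 1 in absolute value, then
  \<open>N\<close> is at least a constant times \<open>log \<bar>\<xi>\<bar>\<close>, and a fixed positive proportion of small factors
  among the first \<open>N\<close> gives a negative power of \<open>\<bar>\<xi>\<bar>\<close> (\<open>fourier_decay_if_nonresonant\<close>).

  Read backwards from time \<open>N\<close>, the phases form an exponential sum
  \<open>x\<^sub>n = \<Sum>\<^sub>i \<eta>\<^sub>i \<theta>\<^sub>i\<^sup>n\<close> with bounded coefficients. By minimality of \<open>N\<close> some coordinate \<open>k\<close> is of order 1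
  at time \<open>N\<close>, and affine irreducibility provides a digit difference whose \<open>k\<close>-th coordinate is
  nonzero, so that \<open>\<eta>\<^sub>k\<close> is bounded away from 0. The exceptional set consists of the \<open>\<theta>\<close> with two
  equal coordinates and of the \<open>\<theta>\<close> for which, for infinitely many \<open>N\<close>, such an exponential sum is
  within \<open>\<rho>\<close> of an integer at all but \<open>\<delta> N\<close> times below \<open>N\<close>. All that remains is to show that the
  latter set is null.

  This is done with the Erdos--Kahane argument in one coordinate at a time. Fix all \<open>\<theta>\<^sub>i\<close> with \<open>i \<noteq> k\<close>.
  Applying the difference operators \<open>x\<^sub>n\<^sub>+\<^sub>1 - \<theta>\<^sub>i x\<^sub>n\<close> for all \<open>i \<noteq> k\<close> turns \<open>x\<close> into the pure geometric
  sequence \<open>y \<theta>\<^sub>k\<^sup>n\<close>. Replace \<open>x\<^sub>n\<close> by the nearest integer \<open>K\<^sub>n\<close>. The images of \<open>K\<close> under the same operators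
  are geometric up to a bounded error, so two consecutive ones predict the third, and \<open>K\<^sub>n\<close> is determined
  by its predecessors up to boundedly many choices, and is determined uniquely where \<open>x\<close> is close to
  integers (\<open>next_integer_close\<close>). Since the coefficients are bounded, there are boundedly many
  ways to begin. So the number of integer sequences of length \<open>N\<close> that occur is at most a constant times
  \<open>exp(\<epsilon> N)\<close>, with \<open>\<epsilon>\<close> small when \<open>\<delta>\<close> is small, whereas a given sequence confines \<open>\<theta>\<^sub>k\<close> to an interval of length comparable to \<open>\<bar>\<theta>\<^sub>k\<bar>\<^sup>-\<^sup>N\<close>
  (\<open>multiplier_close\<close>, \<open>erdos_kahane\<close>). The bad values of \<open>\<theta>\<^sub>k\<close> thus have summable measure, the lemma of Borel
  and Cantelli applies on every line parallel to the \<open>k\<close>-th axis, and a Fubini argument finishes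
  (\<open>limsup_resonant_null\<close>).
\<close>

section \<open>Difference operators and exponential sums\<close>

text \<open>
  This is the operator \<open>\<Prod>\<^sub>a (E - a)\<close>, where \<open>E\<close> is the shift of sequences and \<open>a\<close> runs through the list;
  it kills the geometric sequences with these ratios.
\<close>
fun annihilate :: "real list \<Rightarrow> (nat \<Rightarrow> real) \<Rightarrow> nat \<Rightarrow> real" where
  "annihilate [] x = x"
| "annihilate (a # as) x = (\<lambda>n. annihilate as x (Suc n) - a * annihilate as x n)"

lemma annihilate_diff:
  "annihilate as (\<lambda>k. x k - z k) n = annihilate as x n - annihilate as z n"
  by (induction as arbitrary: n) (simp_all add: right_diff_distrib)

lemma annihilate_abs_le:
  assumes "\<And>a. a \<in> set as \<Longrightarrow> \<bar>a\<bar> \<le> M" and "M \<ge> 0"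
    and "\<And>k. n \<le> k \<Longrightarrow> k \<le> n + length as \<Longrightarrow> \<bar>x k\<bar> \<le> e"
  shows "\<bar>annihilate as x n\<bar> \<le> (1 + M) ^ length as * e"
  using assms
proof (induction as arbitrary: n)
  case Nil
  then show ?case by simp
next
  case (Cons a as)
  let ?B = "(1 + M) ^ length as * e"
  have 1: "\<bar>annihilate as x (Suc n)\<bar> \<le> ?B"
    by (rule Cons.IH) (use Cons.prems in auto)
  have 2: "\<bar>annihilate as x n\<bar> \<le> ?B"
    by (rule Cons.IH) (use Cons.prems in auto)
  have "\<bar>a * annihilate as x n\<bar> \<le> M * ?B"
    unfolding abs_mult using 2 Cons.prems(1)[of a] Cons.prems(2) by (intro mult_mono) auto
  then show ?case
    using 1 by (simp add: algebra_simps)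
qed

text \<open>
  The operator is monic in the shift. So, once the earlier terms are known, its value at \<open>n\<close> carries
  the same information as the single term with index \<open>n + length as\<close>.
\<close>
lemma annihilate_leading_term:
  assumes "\<And>k. n \<le> k \<Longrightarrow> k < n + length as \<Longrightarrow> x k = z k"
  shows "annihilate as x n - annihilate as z n = x (n + length as) - z (n + length as)"
  using assms
proof (induction as arbitrary: n)
  case Nil
  then show ?case by simp
next
  case (Cons a as)
  have "annihilate as x (Suc n) - annihilate as z (Suc n)
      = x (Suc n + length as) - z (Suc n + length as)"
    by (rule Cons.IH) (use Cons.prems in auto)
  moreover have "annihilate as x n - annihilate as z n = x (n + length as) - z (n + length as)"
    by (rule Cons.IH) (use Cons.prems in auto)
  ultimately show ?case
    using Cons.prems[of "n + length as"] by (simp add: algebra_simps)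
qed

lemma annihilate_exponential_sum:
  "annihilate as (\<lambda>n. \<Sum>i\<in>I. \<eta> i * \<theta> i ^ n) n
     = (\<Sum>i\<in>I. \<eta> i * (\<Prod>a\<leftarrow>as. \<theta> i - a) * \<theta> i ^ n)"
  by (induction as arbitrary: n)
     (auto simp: sum_distrib_left sum_subtractf[symmetric] algebra_simps intro!: sum.cong)

text \<open>
  Three nearly geometric terms with the same unknown ratio \<open>t\<close>: the first two determine the third up to a
  multiple of the error, by a formula in which \<open>t\<close> does not occur. The lower bound on \<open>Y0\<close> keeps the estimated
  ratio \<open>Y1 / Y0\<close> within distance 1 of \<open>t\<close>.
\<close>
lemma geometric_prediction:
  fixes Y0 Y1 Y2 t M E :: real
  assumes "\<bar>Y1 - t * Y0\<bar> \<le> E" "\<bar>Y2 - t * Y1\<bar> \<le> E" "\<bar>t\<bar> \<le> M" "E \<le> \<bar>Y0\<bar>" "Y0 \<noteq> 0"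
  shows "\<bar>Y2 - Y1\<^sup>2 / Y0\<bar> \<le> (M + 2) * E"
proof -
  define r where "r = Y1 / Y0"
  have E: "E \<ge> 0" using assms(1) by linarith
  have tr: "t - r = - (Y1 - t * Y0) / Y0"
    using assms(5) by (simp add: r_def field_simps)
  have "\<bar>t - r\<bar> \<le> 1"
    using assms(1,4,5) by (simp add: tr abs_divide)
  then have r: "\<bar>r\<bar> \<le> M + 1"
    using assms(3) by linarith
  have "Y2 - Y1\<^sup>2 / Y0 = (Y2 - t * Y1) - (Y1 - t * Y0) * r"
    using assms(5) by (simp add: r_def field_simps power2_eq_square)
  moreover have "\<bar>(Y1 - t * Y0) * r\<bar> \<le> E * (M + 1)"
    unfolding abs_mult using assms(1) r E by (intro mult_mono) auto
  ultimately show ?thesis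
    using assms(2) by (simp add: algebra_simps)
qed

section \<open>Counting\<close>

text \<open>
  Sequences whose next term is known up to \<open>b n\<close> choices once the previous terms are known form a tree
  with branching numbers \<open>b n\<close>; this counts its nodes on level \<open>N\<close>, starting from level \<open>n0\<close>.
\<close>
lemma card_restrictions_le:
  fixes F :: "(nat \<Rightarrow> 'a) set"
  assumes init: "finite ((\<lambda>K. map K [0..<n0]) ` F)"
    and step: "\<And>n K. n0 \<le> n \<Longrightarrow> n < N \<Longrightarrow> K \<in> F \<Longrightarrow>
      \<exists>V. finite V \<and> card V \<le> b n \<and> (\<forall>K'\<in>F. (\<forall>i<n. K' i = K i) \<longrightarrow> K' n \<in> V)"
    and "n0 \<le> N"
  shows "finite ((\<lambda>K. map K [0..<N]) ` F) \<and>
    card ((\<lambda>K. map K [0..<N]) ` F) \<le> card ((\<lambda>K. map K [0..<n0]) ` F) * (\<Prod>n\<in>{n0..<N}. b n)"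
  using \<open>n0 \<le> N\<close> step
proof (induction N rule: dec_induct)
  case base
  then show ?case using init by simp
next
  case (step n)
  let ?R = "\<lambda>n. (\<lambda>K. map K [0..<n]) ` F"
  have IH: "finite (?R n)" "card (?R n) \<le> card (?R n0) * (\<Prod>n\<in>{n0..<n}. b n)"
    using step.IH step.prems by auto
  have "\<forall>l\<in>?R n. \<exists>V. finite V \<and> card V \<le> b n \<and> (\<forall>K'\<in>F. map K' [0..<n] = l \<longrightarrow> K' n \<in> V)"
  proof
    fix l assume "l \<in> ?R n"
    then obtain K where K: "K \<in> F" "l = map K [0..<n]" by auto
    from step.prems[OF step.hyps(1) lessI K(1)] obtain V
      where "finite V" "card V \<le> b n" "\<forall>K'\<in>F. (\<forall>i<n. K' i = K i) \<longrightarrow> K' n \<in> V"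
      by blast
    then show "\<exists>V. finite V \<and> card V \<le> b n \<and> (\<forall>K'\<in>F. map K' [0..<n] = l \<longrightarrow> K' n \<in> V)"
      using K(2) by (intro exI[of _ V]) auto
  qed
  then obtain V where V: "\<And>l. l \<in> ?R n \<Longrightarrow> finite (V l)" "\<And>l. l \<in> ?R n \<Longrightarrow> card (V l) \<le> b n"
    "\<And>K. K \<in> F \<Longrightarrow> K n \<in> V (map K [0..<n])"
    by (metis (mono_tags, lifting) imageI)
  have sub: "?R (Suc n) \<subseteq> (\<lambda>(l, v). l @ [v]) ` (SIGMA l:?R n. V l)"
  proof
    fix w assume "w \<in> ?R (Suc n)"
    then obtain K where K: "K \<in> F" "w = map K [0..<Suc n]" by auto
    then have "w = (\<lambda>(l, v). l @ [v]) (map K [0..<n], K n)" by simp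
    then show "w \<in> (\<lambda>(l, v). l @ [v]) ` (SIGMA l:?R n. V l)"
      using K V(3) by (intro image_eqI) auto
  qed
  have fin: "finite (SIGMA l:?R n. V l)"
    using IH(1) V(1) by auto
  have "card (?R (Suc n)) \<le> card (SIGMA l:?R n. V l)"
    using sub fin by (meson card_image_le card_mono finite_imageI le_trans)
  also have "\<dots> = (\<Sum>l\<in>?R n. card (V l))"
    using IH(1) V(1) by (intro card_SigmaI) auto
  also have "\<dots> \<le> card (?R n) * b n"
    using sum_bounded_above[of "?R n" "\<lambda>l. card (V l)" "b n"] V(2) by auto
  also have "\<dots> \<le> card (?R n0) * (\<Prod>n\<in>{n0..<n}. b n) * b n"
    using IH(2) by simp
  also have "\<dots> = card (?R n0) * (\<Prod>n\<in>{n0..<Suc n}. b n)"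
    using step.hyps by (simp add: algebra_simps)
  finally show ?case
    using finite_subset[OF sub finite_imageI[OF fin]] by blast
qed

text \<open>
  A time \<open>s\<close> in \<open>S\<close> spoils only the windows of length \<open>Suc w\<close> that contain it, that is, those that end
  between \<open>s\<close> and \<open>s + w\<close>.
\<close>
lemma prod_window_le:
  fixes B w :: nat
  assumes "finite S" "B \<ge> 1" "finite I"
  shows "(\<Prod>n\<in>I. if {n - w..n} \<inter> S = {} then 1 else B) \<le> (B ^ Suc w) ^ card S"
proof -
  let ?H = "{n \<in> I. {n - w..n} \<inter> S \<noteq> {}}"
  have "(\<Prod>n\<in>I. if {n - w..n} \<inter> S = {} then 1 else B) = B ^ card ?H"
    using assms(3) by (simp add: prod.If_cases Collect_neg_eq[symmetric] Int_def)
  also have "\<dots> \<le> B ^ (Suc w * card S)"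
  proof (rule power_increasing[OF _ assms(2)])
    have "?H \<subseteq> (\<Union>s\<in>S. {s..s + w})" by fastforce
    then have "card ?H \<le> card (\<Union>s\<in>S. {s..s + w})"
      using assms(1) by (intro card_mono) auto
    also have "\<dots> \<le> (\<Sum>s\<in>S. card {s..s + w})"
      by (rule card_UN_le[OF assms(1)])
    finally show "card ?H \<le> Suc w * card S" by (simp add: mult.commute)
  qed
  finally show ?thesis by (simp only: power_mult)
qed

text \<open>
  An exponential Markov inequality: on the subsets that occur, \<open>\<tau>\<close> to the power \<open>card S - s\<close> is at least 1, and
  after insertion of this weight the sum over all subsets is a product.
\<close>
lemma sum_power_card_small_subsets_le:
  fixes \<tau> B s :: real
  assumes "finite A" "0 < \<tau>" "\<tau> \<le> 1" "B \<ge> 0"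
  shows "(\<Sum>S | S \<subseteq> A \<and> real (card S) \<le> s. B ^ card S) \<le> \<tau> powr (- s) * (1 + \<tau> * B) ^ card A"
proof -
  have "(\<Sum>S | S \<subseteq> A \<and> real (card S) \<le> s. B ^ card S)
      \<le> (\<Sum>S | S \<subseteq> A \<and> real (card S) \<le> s. \<tau> powr (- s) * (\<tau> * B) ^ card S)"
  proof (rule sum_mono)
    fix S assume "S \<in> {S. S \<subseteq> A \<and> real (card S) \<le> s}"
    then have "\<tau> powr s \<le> \<tau> powr real (card S)"
      using assms by (intro powr_mono') auto
    then have "\<tau> powr (- s) * \<tau> powr s \<le> \<tau> powr (- s) * \<tau> ^ card S"
      using assms by (intro mult_left_mono) (auto simp: powr_realpow)
    then have "1 \<le> \<tau> powr (- s) * \<tau> ^ card S"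
      using assms by (simp add: powr_add[symmetric])
    from mult_right_mono[OF this, of "B ^ card S"]
    show "B ^ card S \<le> \<tau> powr (- s) * (\<tau> * B) ^ card S"
      using assms by (simp add: power_mult_distrib mult.assoc)
  qed
  also have "\<dots> \<le> (\<Sum>S\<in>Pow A. \<tau> powr (- s) * (\<tau> * B) ^ card S)"
    using assms by (intro sum_mono2) auto
  also have "\<dots> = \<tau> powr (- s) * (\<Sum>S\<in>Pow A. (\<Prod>x\<in>S. \<tau> * B) * (\<Prod>x\<in>A - S. 1))"
    by (simp add: sum_distrib_left)
  also have "(\<Sum>S\<in>Pow A. (\<Prod>x\<in>S. \<tau> * B) * (\<Prod>x\<in>A - S. 1)) = (\<Prod>x\<in>A. \<tau> * B + 1)"
    by (rule prod_add[symmetric, OF assms(1)])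
  finally show ?thesis by (simp add: add.commute)
qed

text \<open>
  This makes the exponential growth rate of the number of codings smaller than the rate \<open>1 + \<kappa>\<close> at which
  the intervals shrink: \<open>\<tau>\<close> small makes the second factor close to 1, and then \<open>\<delta>\<close> small does
  the same to the first one.
\<close>
lemma exists_entropy_parameters:
  fixes \<kappa> B :: real
  assumes "\<kappa> > 0" "B \<ge> 1"
  shows "\<exists>\<tau> \<delta>. 0 < \<tau> \<and> \<tau> \<le> 1 \<and> \<delta> > 0 \<and> \<tau> powr (- \<delta>) * (1 + \<tau> * B) < 1 + \<kappa>"
proof -
  define \<tau> where "\<tau> = min 1 (\<kappa> / (2 * B))"
  define q where "q = (1 + \<kappa>) / (1 + \<kappa> / 2)"
  define \<delta> where "\<delta> = ln q / (1 - ln \<tau>)"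
  have \<tau>: "0 < \<tau>" "\<tau> \<le> 1"
    using assms by (auto simp: \<tau>_def)
  have "\<tau> * B \<le> \<kappa> / (2 * B) * B"
    using assms by (intro mult_right_mono) (auto simp: \<tau>_def)
  then have B: "1 + \<tau> * B \<le> 1 + \<kappa> / 2"
    using assms by simp
  have q: "q > 1"
    using assms by (simp add: q_def field_simps)
  have l: "1 - ln \<tau> > 0"
    using \<tau> ln_le_zero_iff[of \<tau>] by linarith
  have \<delta>: "\<delta> > 0"
    using q l by (simp add: \<delta>_def)
  have "\<delta> * (1 - ln \<tau>) = ln q"
    using l by (simp add: \<delta>_def)
  then have "- \<delta> * ln \<tau> < ln q"
    using \<delta> by (simp add: algebra_simps)
  then have "\<tau> powr (- \<delta>) < q"
    using \<tau> q by (subst ln_less_cancel_iff[symmetric]) (auto simp: ln_powr)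
  then have "\<tau> powr (- \<delta>) * (1 + \<tau> * B) < q * (1 + \<kappa> / 2)"
    using B \<tau> assms q by (intro mult_less_le_imp_less) (auto intro!: add_pos_pos)
  also have "\<dots> = 1 + \<kappa>"
    using assms by (simp add: q_def)
  finally show ?thesis using \<tau> \<delta> by blast
qed

section \<open>Rounding a single exponential\<close>

text \<open>
  The pairs of a ratio \<open>t\<close> and a sequence \<open>x\<close> that becomes a multiple of \<open>t\<^sup>n\<close> after all other ratios, listed
  in \<open>as\<close>, have been removed, and that stays \<open>\<rho>\<close>-close to the integers up to time \<open>N\<close> except at the times
  in \<open>S\<close>. The bound \<open>c\<close> makes the surviving component visible above the rounding errors; \<open>R\<close> bounds the
  number of possible beginnings of \<open>x\<close>.
\<close>
definition single_orbits ::
  "real list \<Rightarrow> real \<Rightarrow> real \<Rightarrow> real \<Rightarrow> real \<Rightarrow> real \<Rightarrow> nat set \<Rightarrow> nat \<Rightarrow> (real \<times> (nat \<Rightarrow> real)) set" where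
  "single_orbits as M \<kappa> c R \<rho> S N = {(t, x).
     1 + \<kappa> \<le> \<bar>t\<bar> \<and> \<bar>t\<bar> \<le> M \<and>
     (\<exists>y. c \<le> \<bar>y\<bar> \<and> (\<forall>n. annihilate as x n = y * t ^ n)) \<and>
     (\<forall>n. \<bar>x n\<bar> \<le> R * M ^ n) \<and>
     (\<forall>n\<in>{..<N} - S. \<bar>x n - round (x n)\<bar> \<le> \<rho>)}"

lemma annihilate_round_close:
  fixes x :: "nat \<Rightarrow> real"
  assumes as: "\<And>a. a \<in> set as \<Longrightarrow> \<bar>a\<bar> \<le> M" "M \<ge> 0"
    and e: "\<And>k. n \<le> k \<Longrightarrow> k \<le> n + length as \<Longrightarrow> \<bar>x k - round (x k)\<bar> \<le> e"
  shows "\<bar>annihilate as x n - annihilate as (\<lambda>k. round (x k)) n\<bar> \<le> (1 + M) ^ length as * e"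
  unfolding annihilate_diff[symmetric] by (rule annihilate_abs_le) (use assms in auto)

lemma annihilate_round_recurrence:
  fixes t y :: real and x :: "nat \<Rightarrow> real"
  assumes as: "\<And>a. a \<in> set as \<Longrightarrow> \<bar>a\<bar> \<le> M" "\<bar>t\<bar> \<le> M"
    and y: "\<And>n. annihilate as x n = y * t ^ n"
    and e: "\<And>k. n \<le> k \<Longrightarrow> k \<le> n + length as + 1 \<Longrightarrow> \<bar>x k - round (x k)\<bar> \<le> e"
  shows "\<bar>annihilate as (\<lambda>k. round (x k)) (Suc n) - t * annihilate as (\<lambda>k. round (x k)) n\<bar>
    \<le> (1 + M) * ((1 + M) ^ length as * e)"
proof -
  let ?Y = "annihilate as (\<lambda>k. real_of_int (round (x k)))" and ?L = "(1 + M) ^ length as * e"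
  have M: "M \<ge> 0" using as(2) by linarith
  have 0: "\<bar>y * t ^ n - ?Y n\<bar> \<le> ?L"
    using annihilate_round_close[OF as(1) M, of as n x e] e y by simp
  have 1: "\<bar>y * t ^ Suc n - ?Y (Suc n)\<bar> \<le> ?L"
    using annihilate_round_close[OF as(1) M, of as "Suc n" x e] e y by simp
  have "?Y (Suc n) - t * ?Y n = t * (y * t ^ n - ?Y n) - (y * t ^ Suc n - ?Y (Suc n))"
    by (simp add: algebra_simps)
  moreover have "\<bar>t * (y * t ^ n - ?Y n)\<bar> \<le> M * ?L"
    unfolding abs_mult using 0 as(2) M by (intro mult_mono) auto
  ultimately show ?thesis
    using 1 by (simp add: algebra_simps)
qed

text \<open>
  The surviving component grows like \<open>(1 + \<kappa>)\<^sup>n\<close>, so from some time on it dominates the rounding error.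
  The two bounds serve to divide by this quantity: the first one to locate \<open>t\<close>, the second one in
  \<open>geometric_prediction\<close>.
\<close>
lemma annihilate_round_large:
  fixes t y \<kappa> c M :: real and x :: "nat \<Rightarrow> real"
  assumes as: "\<And>a. a \<in> set as \<Longrightarrow> \<bar>a\<bar> \<le> M" "1 + \<kappa> \<le> \<bar>t\<bar>" "\<bar>t\<bar> \<le> M" "\<kappa> > 0"
    and y: "\<And>n. annihilate as x n = y * t ^ n" "c \<le> \<bar>y\<bar>" "c > 0"
    and big: "(2 + M) * (1 + M) ^ length as \<le> c * (1 + \<kappa>) ^ n"
  shows "c * (1 + \<kappa>) ^ n / 2 \<le> \<bar>annihilate as (\<lambda>k. round (x k)) n\<bar>"
    and "(1 + M) * ((1 + M) ^ length as * (1/2)) \<le> \<bar>annihilate as (\<lambda>k. round (x k)) n\<bar>"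
proof -
  let ?Y = "annihilate as (\<lambda>k. real_of_int (round (x k)))" and ?L = "(1 + M) ^ length as"
  have M: "M \<ge> 0" using as by linarith
  have 0: "\<bar>y * t ^ n - ?Y n\<bar> \<le> ?L * (1/2)"
    using annihilate_round_close[OF as(1) M, of as n x "1/2"] y of_int_round_abs_le[where 'a=real]
    by (simp add: abs_minus_commute)
  have "c * (1 + \<kappa>) ^ n \<le> \<bar>y\<bar> * \<bar>t\<bar> ^ n"
    using as y by (intro mult_mono power_mono) auto
  then have 1: "c * (1 + \<kappa>) ^ n \<le> \<bar>y * t ^ n\<bar>"
    by (simp add: abs_mult power_abs)
  have "?L \<le> (2 + M) * ?L" "(1 + M) * ?L + ?L \<le> (2 + M) * ?L" "(1 + M) * ?L \<ge> 0"
    using M by (auto simp: algebra_simps)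
  with 0 1 big show "c * (1 + \<kappa>) ^ n / 2 \<le> \<bar>?Y n\<bar>"
    "(1 + M) * (?L * (1/2)) \<le> \<bar>?Y n\<bar>"
    by linarith+
qed

text \<open>
  Two orbits with a common past have the same two transformed integers at \<open>n\<close> and \<open>n + 1\<close>, hence the same
  prediction for the third, although their ratios \<open>t\<close> and \<open>t'\<close> may differ. The window \<open>{n..n + length as + 2}\<close>
  consists of the indices that enter these three values.
\<close>
lemma next_integer_close:
  fixes \<kappa> c M :: real
  assumes as: "\<And>a. a \<in> set as \<Longrightarrow> \<bar>a\<bar> \<le> M" "\<kappa> > 0" "c > 0"
    and big: "(2 + M) * (1 + M) ^ length as \<le> c * (1 + \<kappa>) ^ n"
    and mem: "(t, x) \<in> single_orbits as M \<kappa> c R \<rho> S N" "(t', x') \<in> single_orbits as M \<kappa> c R \<rho> S N"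
    and agree: "\<And>k. k < n + length as + 2 \<Longrightarrow> round (x k) = round (x' k)"
    and e: "\<And>k. n \<le> k \<Longrightarrow> k \<le> n + length as + 2 \<Longrightarrow>
              \<bar>x k - round (x k)\<bar> \<le> e \<and> \<bar>x' k - round (x' k)\<bar> \<le> e" and "e \<le> 1/2"
  shows "\<bar>real_of_int (round (x (n + length as + 2)) - round (x' (n + length as + 2)))\<bar>
      \<le> 2 * (M + 2) * ((1 + M) * ((1 + M) ^ length as * e))"
proof -
  let ?Y = "annihilate as (\<lambda>k. real_of_int (round (x k)))"
  let ?Y' = "annihilate as (\<lambda>k. real_of_int (round (x' k)))"
  let ?E = "(1 + M) * ((1 + M) ^ length as * e)"
  obtain y where x: "1 + \<kappa> \<le> \<bar>t\<bar>" "\<bar>t\<bar> \<le> M" "c \<le> \<bar>y\<bar>" "\<And>n. annihilate as x n = y * t ^ n"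
    using mem(1) unfolding single_orbits_def by auto
  obtain y' where x': "1 + \<kappa> \<le> \<bar>t'\<bar>" "\<bar>t'\<bar> \<le> M" "c \<le> \<bar>y'\<bar>" "\<And>n. annihilate as x' n = y' * t' ^ n"
    using mem(2) unfolding single_orbits_def by auto
  have M: "M \<ge> 0" using x by linarith
  have eq: "?Y' n = ?Y n" "?Y' (Suc n) = ?Y (Suc n)"
    using annihilate_leading_term[of n as "\<lambda>k. real_of_int (round (x' k))" "\<lambda>k. real_of_int (round (x k))"]
      annihilate_leading_term[of "Suc n" as "\<lambda>k. real_of_int (round (x' k))" "\<lambda>k. real_of_int (round (x k))"]
      agree by auto
  have "?E \<le> (1 + M) * ((1 + M) ^ length as * (1/2))"
    using M \<open>e \<le> 1/2\<close> by (intro mult_left_mono) auto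
  also have "\<dots> \<le> \<bar>?Y n\<bar>"
    by (rule annihilate_round_large(2)) (use as x big in auto)
  finally have EY: "?E \<le> \<bar>?Y n\<bar>" .
  have "0 < c * (1 + \<kappa>) ^ n / 2"
    using as by simp
  also have "\<dots> \<le> \<bar>?Y n\<bar>"
    by (rule annihilate_round_large(1)) (use as x big in auto)
  finally have Y0: "?Y n \<noteq> 0" by auto
  have r: "\<bar>?Y (Suc n) - t * ?Y n\<bar> \<le> ?E" "\<bar>?Y (Suc (Suc n)) - t * ?Y (Suc n)\<bar> \<le> ?E"
    by (rule annihilate_round_recurrence[OF as(1) x(2) x(4)]; use e in simp)+
  have r': "\<bar>?Y (Suc n) - t' * ?Y n\<bar> \<le> ?E" "\<bar>?Y' (Suc (Suc n)) - t' * ?Y (Suc n)\<bar> \<le> ?E"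
    unfolding eq[symmetric]
    by (rule annihilate_round_recurrence[OF as(1) x'(2) x'(4)]; use e in simp)+
  have "\<bar>?Y (Suc (Suc n)) - (?Y (Suc n))\<^sup>2 / ?Y n\<bar> \<le> (M + 2) * ?E"
    using r x(2) EY Y0 by (rule geometric_prediction)
  moreover have "\<bar>?Y' (Suc (Suc n)) - (?Y (Suc n))\<^sup>2 / ?Y n\<bar> \<le> (M + 2) * ?E"
    using r' x'(2) EY Y0 by (rule geometric_prediction)
  ultimately have "\<bar>?Y (Suc (Suc n)) - ?Y' (Suc (Suc n))\<bar> \<le> 2 * (M + 2) * ?E"
    by linarith
  moreover have "?Y (Suc (Suc n)) - ?Y' (Suc (Suc n))
      = real_of_int (round (x (n + length as + 2))) - real_of_int (round (x' (n + length as + 2)))"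
    using annihilate_leading_term[of "Suc (Suc n)" as "\<lambda>k. real_of_int (round (x k))"
        "\<lambda>k. real_of_int (round (x' k))"] agree by simp
  ultimately show ?thesis by simp
qed

text \<open>
  The integers determine the ratio: both \<open>t\<close> and \<open>t'\<close> are close to the quotient of the same two consecutive
  transformed integers, whose denominator is of size \<open>(1 + \<kappa>)\<^sup>n\<close>.
\<close>
lemma multiplier_close:
  fixes \<kappa> c M :: real
  assumes as: "\<And>a. a \<in> set as \<Longrightarrow> \<bar>a\<bar> \<le> M" "\<kappa> > 0" "c > 0"
    and big: "(2 + M) * (1 + M) ^ length as \<le> c * (1 + \<kappa>) ^ n"
    and mem: "(t, x) \<in> single_orbits as M \<kappa> c R \<rho> S N" "(t', x') \<in> single_orbits as M \<kappa> c R \<rho> S N"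
    and agree: "\<And>k. k < n + length as + 2 \<Longrightarrow> round (x k) = round (x' k)"
  shows "\<bar>t - t'\<bar> \<le> 2 * (1 + M) ^ Suc (length as) / c / (1 + \<kappa>) ^ n"
proof -
  let ?Y = "annihilate as (\<lambda>k. real_of_int (round (x k)))"
  let ?Y' = "annihilate as (\<lambda>k. real_of_int (round (x' k)))"
  let ?E = "(1 + M) * ((1 + M) ^ length as * (1/2))"
  obtain y where x: "1 + \<kappa> \<le> \<bar>t\<bar>" "\<bar>t\<bar> \<le> M" "c \<le> \<bar>y\<bar>" "\<And>n. annihilate as x n = y * t ^ n"
    using mem(1) unfolding single_orbits_def by auto
  obtain y' where x': "1 + \<kappa> \<le> \<bar>t'\<bar>" "\<bar>t'\<bar> \<le> M" "c \<le> \<bar>y'\<bar>" "\<And>n. annihilate as x' n = y' * t' ^ n"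
    using mem(2) unfolding single_orbits_def by auto
  have M: "M \<ge> 0" using x by linarith
  have eq: "?Y' n = ?Y n" "?Y' (Suc n) = ?Y (Suc n)"
    using annihilate_leading_term[of n as "\<lambda>k. real_of_int (round (x' k))" "\<lambda>k. real_of_int (round (x k))"]
      annihilate_leading_term[of "Suc n" as "\<lambda>k. real_of_int (round (x' k))" "\<lambda>k. real_of_int (round (x k))"]
      agree by auto
  have half: "\<bar>u - real_of_int (round u)\<bar> \<le> 1/2" for u :: real
    using of_int_round_abs_le[of u] by (simp add: abs_minus_commute)
  have r: "\<bar>?Y (Suc n) - t * ?Y n\<bar> \<le> ?E"
    by (rule annihilate_round_recurrence[OF as(1) x(2) x(4)]; use half in simp)
  have r': "\<bar>?Y (Suc n) - t' * ?Y n\<bar> \<le> ?E"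
    unfolding eq[symmetric]
    by (rule annihilate_round_recurrence[OF as(1) x'(2) x'(4)]; use half in simp)
  have Y: "c * (1 + \<kappa>) ^ n / 2 \<le> \<bar>?Y n\<bar>"
    by (rule annihilate_round_large(1)) (use as x big in auto)
  have pos: "0 < c * (1 + \<kappa>) ^ n"
    using as by simp
  have "\<bar>t - t'\<bar> * (c * (1 + \<kappa>) ^ n / 2) \<le> \<bar>t - t'\<bar> * \<bar>?Y n\<bar>"
    using Y by (intro mult_left_mono) auto
  also have "\<dots> = \<bar>(?Y (Suc n) - t' * ?Y n) - (?Y (Suc n) - t * ?Y n)\<bar>"
    by (simp add: abs_mult[symmetric] algebra_simps)
  also have "\<dots> \<le> 2 * ?E"
    using r r' by linarith
  finally have "\<bar>t - t'\<bar> * (c * (1 + \<kappa>) ^ n) \<le> 2 * (1 + M) ^ Suc (length as)"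
    by simp
  then have "\<bar>t - t'\<bar> \<le> 2 * (1 + M) ^ Suc (length as) / (c * (1 + \<kappa>) ^ n)"
    using pos by (simp only: pos_le_divide_eq)
  then show ?thesis by (simp add: field_simps)
qed

section \<open>The Erdos--Kahane estimate\<close>

text \<open>
  The number of integers at distance at most \<open>(M + 2) (1 + M)\<^sup>D\<^sup>+\<^sup>1\<close> from a given one. This radius is
  the bound in \<open>next_integer_close\<close> for the trivial rounding error \<open>1/2\<close>. It does not depend on \<open>c\<close> and \<open>R\<close>,
  which allows \<open>\<delta>\<close> to be chosen before the other ratios are fixed.
\<close>
definition branching :: "real \<Rightarrow> nat \<Rightarrow> nat" where
  "branching M D = nat (2 * \<lfloor>(M + 2) * (1 + M) ^ Suc D\<rfloor> + 1)"

lemma branching_ge_1: "M \<ge> 0 \<Longrightarrow> branching M D \<ge> 1"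
proof -
  assume "M \<ge> 0"
  then have "\<lfloor>(M + 2) * (1 + M) ^ Suc D\<rfloor> \<ge> 0" by simp
  then show ?thesis unfolding branching_def by linarith
qed

text \<open>
  Away from \<open>S\<close> two candidates for the next integer differ by less than 1, so it is forced; this is where the
  smallness of \<open>\<rho>\<close> enters. Near \<open>S\<close> only the trivial rounding error is available.
\<close>
lemma next_integer_few_choices:
  fixes \<kappa> c M \<rho> :: real
  assumes as: "\<And>a. a \<in> set as \<Longrightarrow> \<bar>a\<bar> \<le> M" "\<kappa> > 0" "c > 0" "M \<ge> 0"
    and \<rho>: "2 * (M + 2) * (1 + M) ^ Suc (length as) * \<rho> < 1" "\<rho> \<le> 1/2"
    and big: "\<And>n. start \<le> n \<Longrightarrow> (2 + M) * (1 + M) ^ length as \<le> c * (1 + \<kappa>) ^ n"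
    and n: "start + length as + 2 \<le> n" "n < N"
    and K: "K \<in> (\<lambda>(t, x) k. round (x k)) ` single_orbits as M \<kappa> c R \<rho> S N"
  shows "\<exists>V. finite V \<and>
    card V \<le> (if {n - (length as + 2)..n} \<inter> S = {} then 1 else branching M (length as)) \<and>
    (\<forall>K'\<in>(\<lambda>(t, x) k. round (x k)) ` single_orbits as M \<kappa> c R \<rho> S N.
       (\<forall>i<n. K' i = K i) \<longrightarrow> K' n \<in> V)"
proof -
  define n' where "n' = n - (length as + 2)"
  have n': "n = n' + length as + 2" "start \<le> n'"
    using n by (auto simp: n'_def)
  obtain t x where x: "(t, x) \<in> single_orbits as M \<kappa> c R \<rho> S N" "K = (\<lambda>k. round (x k))"
    using K by auto
  have half: "\<bar>u - real_of_int (round u)\<bar> \<le> 1/2" for u :: real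
    using of_int_round_abs_le[of u] by (simp add: abs_minus_commute)
  show ?thesis
  proof (cases "{n - (length as + 2)..n} \<inter> S = {}")
    case True
    have "K' n \<in> {K n}" if K': "K' \<in> (\<lambda>(t, x) k. round (x k)) ` single_orbits as M \<kappa> c R \<rho> S N"
      "\<forall>i<n. K' i = K i" for K'
    proof -
      obtain t' x' where x': "(t', x') \<in> single_orbits as M \<kappa> c R \<rho> S N" "K' = (\<lambda>k. round (x' k))"
        using K' by auto
      have "\<bar>real_of_int (round (x (n' + length as + 2)) - round (x' (n' + length as + 2)))\<bar>
          \<le> 2 * (M + 2) * ((1 + M) * ((1 + M) ^ length as * \<rho>))"
      proof (rule next_integer_close[OF as(1-3) big[OF n'(2)] x(1) x'(1)])
        show "round (x k) = round (x' k)" if "k < n' + length as + 2" for k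
          using K'(2) that n' by (auto simp: x(2) x'(2))
        show "\<bar>x k - round (x k)\<bar> \<le> \<rho> \<and> \<bar>x' k - round (x' k)\<bar> \<le> \<rho>"
          if "n' \<le> k" "k \<le> n' + length as + 2" for k
        proof -
          have "k \<in> {..<N} - S"
            using True that n n' by auto
          then show ?thesis
            using x(1) x'(1) unfolding single_orbits_def by auto
        qed
      qed (use as \<rho> in auto)
      then have "\<bar>real_of_int (K n - K' n)\<bar> < 1"
        using \<rho>(1) n'(1) by (simp add: x(2) x'(2) algebra_simps)
      then have "\<bar>K n - K' n\<bar> < 1" by linarith
      then show ?thesis by simp
    qed
    then show ?thesis
      using True by (intro exI[of _ "{K n}"]) auto
  next
    case False
    define q where "q = \<lfloor>(M + 2) * (1 + M) ^ Suc (length as)\<rfloor>"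
    have "K' n \<in> {K n - q..K n + q}"
      if K': "K' \<in> (\<lambda>(t, x) k. round (x k)) ` single_orbits as M \<kappa> c R \<rho> S N"
      "\<forall>i<n. K' i = K i" for K'
    proof -
      obtain t' x' where x': "(t', x') \<in> single_orbits as M \<kappa> c R \<rho> S N" "K' = (\<lambda>k. round (x' k))"
        using K' by auto
      have "\<bar>real_of_int (round (x (n' + length as + 2)) - round (x' (n' + length as + 2)))\<bar>
          \<le> 2 * (M + 2) * ((1 + M) * ((1 + M) ^ length as * (1/2)))"
      proof (rule next_integer_close[OF as(1-3) big[OF n'(2)] x(1) x'(1)])
        show "round (x k) = round (x' k)" if "k < n' + length as + 2" for k
          using K'(2) that n' by (auto simp: x(2) x'(2))
      qed (use as half in auto)
      then have "real_of_int \<bar>K n - K' n\<bar> \<le> (M + 2) * (1 + M) ^ Suc (length as)"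
        using n'(1) by (simp add: x(2) x'(2) algebra_simps)
      then have "\<bar>K n - K' n\<bar> \<le> q"
        unfolding q_def by (simp add: le_floor_iff)
      then show ?thesis by auto
    qed
    moreover have "card {K n - q..K n + q} \<le> branching M (length as)"
      by (simp add: branching_def q_def)
    ultimately show ?thesis
      using False by (intro exI[of _ "{K n - q..K n + q}"]) auto
  qed
qed

text \<open>
  The ratios are covered by one interval for each integer coding of length \<open>N\<close>. The codings are counted from a
  time \<open>n0\<close> after which \<open>annihilate_round_large\<close> applies; the number \<open>C0\<close> of initial segments
  does not depend on \<open>N\<close> and \<open>S\<close>. Covers instead of the sets themselves avoid the
  question whether the latter are measurable.
\<close>
lemma measure_single_orbits_le:
  fixes \<kappa> c M \<rho> R :: real
  assumes as: "\<And>a. a \<in> set as \<Longrightarrow> \<bar>a\<bar> \<le> M" "\<kappa> > 0" "c > 0" "M \<ge> 1" "R \<ge> 0"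
    and \<rho>: "2 * (M + 2) * (1 + M) ^ Suc (length as) * \<rho> < 1" "\<rho> \<le> 1/2"
  shows "\<exists>C\<ge>0. \<exists>N0. \<forall>N\<ge>N0. \<forall>S\<subseteq>{..<N}. \<exists>U\<in>sets borel.
    fst ` single_orbits as M \<kappa> c R \<rho> S N \<subseteq> U \<and>
    emeasure lborel U
      \<le> ennreal (C * real (branching M (length as) ^ (length as + 3)) ^ card S / (1 + \<kappa>) ^ N)"
proof -
  define D where "D = length as"
  obtain m0 where m0: "(2 + M) * (1 + M) ^ D / c < (1 + \<kappa>) ^ m0"
    using real_arch_pow[of "1 + \<kappa>"] as(2) by auto
  have big: "(2 + M) * (1 + M) ^ length as \<le> c * (1 + \<kappa>) ^ n" if "m0 \<le> n" for n
  proof -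
    have "(2 + M) * (1 + M) ^ D \<le> c * (1 + \<kappa>) ^ m0"
      using m0 as(3) by (simp add: field_simps)
    also have "\<dots> \<le> c * (1 + \<kappa>) ^ n"
      using as that by (intro mult_left_mono power_increasing) auto
    finally show ?thesis by (simp add: D_def)
  qed
  define n0 where "n0 = m0 + D + 2"
  define b where "b = \<lceil>R * M ^ n0\<rceil> + 1"
  define L0 where "L0 = {l :: int list. set l \<subseteq> {-b..b} \<and> length l = n0}"
  define C0 where "C0 = real (card L0)"
  define C1 where "C1 = 2 * (1 + M) ^ Suc D / c * (1 + \<kappa>) ^ (D + 2)"
  have finL0: "finite L0"
    unfolding L0_def by (intro finite_lists_length_eq) simp
  have "C0 * 2 * C1 \<ge> 0"
    unfolding C0_def C1_def using as by simp
  moreover have "\<exists>U\<in>sets borel. fst ` single_orbits as M \<kappa> c R \<rho> S N \<subseteq> U \<and>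
    emeasure lborel U
    \<le> ennreal (C0 * 2 * C1 * real (branching M (length as) ^ (length as + 3)) ^ card S / (1 + \<kappa>) ^ N)"
    if N: "n0 \<le> N" and S: "S \<subseteq> {..<N}" for N S
  proof -
    let ?O = "single_orbits as M \<kappa> c R \<rho> S N"
    define F where "F = (\<lambda>(t, x) k. round (x k)) ` ?O"
    define codes where "codes = (\<lambda>n. (\<lambda>K. map K [0..<n]) ` F)"
    have init: "codes n0 \<subseteq> L0"
    proof -
      have "round (x k) \<in> {-b..b}" if x: "(t, x) \<in> ?O" and k: "k < n0" for t x k
      proof -
        have "\<bar>x k\<bar> \<le> R * M ^ k"
          using x unfolding single_orbits_def by auto
        also have "\<dots> \<le> R * M ^ n0"
          using as k by (intro mult_left_mono power_increasing) auto
        finally have "\<bar>x k\<bar> \<le> R * M ^ n0" .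
        moreover have "\<bar>real_of_int (round (x k)) - x k\<bar> \<le> 1/2"
          by (rule of_int_round_abs_le)
        ultimately have "\<bar>real_of_int (round (x k))\<bar> \<le> real_of_int b"
          unfolding b_def by linarith
        then show ?thesis by auto
      qed
      then show ?thesis
        unfolding codes_def F_def L0_def by fastforce
    qed
    then have fin0: "finite (codes n0)"
      using finL0 finite_subset by blast
    have "finite (codes N) \<and> card (codes N) \<le> card (codes n0) *
      (\<Prod>n\<in>{n0..<N}. if {n - (D + 2)..n} \<inter> S = {} then 1 else branching M D)"
      unfolding codes_def
    proof (rule card_restrictions_le[OF fin0[unfolded codes_def] _ N])
      fix n K assume "n0 \<le> n" "n < N" "K \<in> F"
      then show "\<exists>V. finite V \<and>
        card V \<le> (if {n - (D + 2)..n} \<inter> S = {} then 1 else branching M D) \<and>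
        (\<forall>K'\<in>F. (\<forall>i<n. K' i = K i) \<longrightarrow> K' n \<in> V)"
        unfolding F_def D_def using as \<rho> big n0_def D_def
        by (intro next_integer_few_choices[where start = m0]) auto
    qed
    moreover have "(\<Prod>n\<in>{n0..<N}. if {n - (D + 2)..n} \<inter> S = {} then 1 else branching M D)
        \<le> (branching M D ^ (D + 3)) ^ card S"
      using prod_window_le[of S "branching M D" "{n0..<N}" "D + 2"] finite_subset[OF S]
        branching_ge_1[of M D] as(4) by (simp add: numeral_3_eq_3)
    moreover have "card (codes n0) \<le> card L0"
      using init finL0 by (rule card_mono[rotated])
    ultimately have finN: "finite (codes N)"
      and cardN: "card (codes N) \<le> card L0 * (branching M D ^ (D + 3)) ^ card S"
      using mult_le_mono order_trans by blast+
    have "\<forall>l\<in>codes N. \<exists>t x. (t, x) \<in> ?O \<and> map (\<lambda>k. round (x k)) [0..<N] = l"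
      unfolding codes_def F_def by auto
    then obtain T X where TX: "\<And>l. l \<in> codes N \<Longrightarrow> (T l, X l) \<in> ?O"
      "\<And>l. l \<in> codes N \<Longrightarrow> map (\<lambda>k. round (X l k)) [0..<N] = l"
      by metis
    define r where "r = C1 / (1 + \<kappa>) ^ N"
    have r0: "r \<ge> 0"
      unfolding r_def C1_def using as by simp
    have cover: "fst ` ?O \<subseteq> (\<Union>l\<in>codes N. cball (T l) r)"
    proof
      fix t assume "t \<in> fst ` ?O"
      then obtain x where x: "(t, x) \<in> ?O" by auto
      define l where "l = map (\<lambda>k. round (x k)) [0..<N]"
      have l: "l \<in> codes N"
        using x unfolding codes_def F_def l_def by force
      define n where "n = N - (D + 2)"
      have n: "N = n + length as + 2" "m0 \<le> n"
        using N by (auto simp: n_def n0_def D_def)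
      have "\<bar>t - T l\<bar> \<le> 2 * (1 + M) ^ Suc (length as) / c / (1 + \<kappa>) ^ n"
      proof (rule multiplier_close[OF as(1-3) big[OF n(2)] x TX(1)[OF l]])
        show "round (x k) = round (X l k)" if "k < n + length as + 2" for k
        proof -
          have kN: "k < N"
            using that n(1) by simp
          have "l ! k = round (x k)"
            unfolding l_def using kN by (simp del: upt_Suc)
          moreover have "map (\<lambda>k. round (X l k)) [0..<N] ! k = round (X l k)"
            using kN by (simp del: upt_Suc)
          ultimately show ?thesis
            unfolding TX(2)[OF l] by (simp only:)
        qed
      qed
      also have "\<dots> = r"
      proof -
        have "(1 + \<kappa>) ^ N = (1 + \<kappa>) ^ n * (1 + \<kappa>) ^ (D + 2)"
          using n(1) by (simp add: D_def power_add)
        then show ?thesis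
          using as(2) by (simp add: r_def C1_def D_def)
      qed
      finally show "t \<in> (\<Union>l\<in>codes N. cball (T l) r)"
        using l by (auto simp: dist_real_def abs_minus_commute)
    qed
    have "emeasure lborel (\<Union>l\<in>codes N. cball (T l) r) \<le> (\<Sum>l\<in>codes N. emeasure lborel (cball (T l) r))"
      using finN by (intro emeasure_subadditive_finite) auto
    also have "\<dots> = (\<Sum>l\<in>codes N. ennreal (2 * r))"
      using r0 by (simp add: cball_eq_atLeastAtMost)
    also have "\<dots> = ennreal (real (card (codes N)) * (2 * r))"
      using r0 by (simp add: ennreal_mult ennreal_of_nat_eq_real_of_nat)
    also have "\<dots> \<le> ennreal (real (card L0 * (branching M D ^ (D + 3)) ^ card S) * (2 * r))"
      using cardN r0 by (intro ennreal_leI mult_right_mono of_nat_mono) auto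
    also have "real (card L0 * (branching M D ^ (D + 3)) ^ card S) * (2 * r)
        = C0 * 2 * C1 * real (branching M (length as) ^ (length as + 3)) ^ card S / (1 + \<kappa>) ^ N"
      by (simp add: r_def C0_def D_def)
    finally have "emeasure lborel (\<Union>l\<in>codes N. cball (T l) r) \<le> ennreal (C0 * 2 * C1 *
        real (branching M (length as) ^ (length as + 3)) ^ card S / (1 + \<kappa>) ^ N)" .
    moreover have "(\<Union>l\<in>codes N. cball (T l) r) \<in> sets borel"
      using finN by (intro sets.finite_UN) auto
    ultimately show ?thesis
      using cover by blast
  qed
  ultimately show ?thesis by blast
qed

text \<open>
  The order of the quantifiers matters: \<open>\<rho>\<close> and \<open>\<delta>\<close> depend only on \<open>M\<close>, \<open>\<kappa>\<close> and the number of ratios, so that one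
  exceptional set serves all values of the other ratios.
\<close>
lemma erdos_kahane:
  fixes M \<kappa> :: real
  assumes "\<kappa> > 0" "M \<ge> 1"
  shows "\<exists>\<rho> \<delta>. 0 < \<rho> \<and> \<rho> < 1/2 \<and> 0 < \<delta> \<and>
    (\<forall>as c R. length as = D \<longrightarrow> (\<forall>a\<in>set as. \<bar>a\<bar> \<le> M) \<longrightarrow> c > 0 \<longrightarrow> R \<ge> 0 \<longrightarrow>
      (\<exists>C\<ge>0. \<exists>\<gamma>\<ge>0. \<gamma> < 1 \<and> (\<exists>N0. \<forall>N\<ge>N0. \<exists>U\<in>sets borel.
        (\<forall>S\<subseteq>{..<N}. real (card S) \<le> \<delta> * real N \<longrightarrow> fst ` single_orbits as M \<kappa> c R \<rho> S N \<subseteq> U) \<and>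
        emeasure lborel U \<le> ennreal (C * \<gamma> ^ N))))"
proof -
  define B where "B = real (branching M D ^ (D + 3))"
  have "1 \<le> branching M D ^ (D + 3)"
    using branching_ge_1[of M D] assms by (intro one_le_power) auto
  then have B: "B \<ge> 1" unfolding B_def by linarith
  obtain \<tau> \<delta> where \<tau>: "0 < \<tau>" "\<tau> \<le> 1" "\<delta> > 0" "\<tau> powr (- \<delta>) * (1 + \<tau> * B) < 1 + \<kappa>"
    using exists_entropy_parameters[OF assms(1) B] by blast
  \<comment> \<open>With this \<open>\<rho>\<close> two candidates for the next integer away from \<open>S\<close> differ by at most \<open>1/2\<close>.\<close>
  define P where "P = (M + 2) * (1 + M) ^ Suc D"
  define \<rho> where "\<rho> = 1 / (4 * P)"
  have P: "1 \<le> P"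
    unfolding P_def using assms mult_mono[of 1 "M + 2" 1 "(1 + M) ^ Suc D"]
      one_le_power[of "1 + M" "Suc D"] by linarith
  then have "0 < \<rho>" "\<rho> < 1/2" "2 * P * \<rho> < 1"
    by (simp_all add: \<rho>_def field_simps)
  then have \<rho>: "0 < \<rho>" "\<rho> < 1/2" "2 * (M + 2) * (1 + M) ^ Suc D * \<rho> < 1"
    unfolding P_def by (simp_all only: mult.assoc)
  define \<gamma> where "\<gamma> = \<tau> powr (- \<delta>) * (1 + \<tau> * B) / (1 + \<kappa>)"
  have \<gamma>: "\<gamma> \<ge> 0" "\<gamma> < 1"
    using \<tau> assms B by (auto simp: \<gamma>_def)
  have core: "\<exists>C\<ge>0. \<exists>N0. \<forall>N\<ge>N0. \<exists>U\<in>sets borel.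
        (\<forall>S\<subseteq>{..<N}. real (card S) \<le> \<delta> * real N \<longrightarrow> fst ` single_orbits as M \<kappa> c R \<rho> S N \<subseteq> U) \<and>
        emeasure lborel U \<le> ennreal (C * \<gamma> ^ N)"
    if as: "length as = D" "\<forall>a\<in>set as. \<bar>a\<bar> \<le> M" "c > 0" "R \<ge> 0" for as c R
  proof -
    obtain C N0 where C: "C \<ge> 0" and "\<forall>N\<ge>N0. \<forall>S\<subseteq>{..<N}. \<exists>U\<in>sets borel.
        fst ` single_orbits as M \<kappa> c R \<rho> S N \<subseteq> U \<and> emeasure lborel U
        \<le> ennreal (C * real (branching M (length as) ^ (length as + 3)) ^ card S / (1 + \<kappa>) ^ N)"
      using measure_single_orbits_le[of as M \<kappa> c R \<rho>] as assms \<rho> by auto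
    then have "\<forall>N\<ge>N0. \<forall>S\<in>{S. S \<subseteq> {..<N} \<and> real (card S) \<le> \<delta> * real N}. \<exists>U\<in>sets borel.
        fst ` single_orbits as M \<kappa> c R \<rho> S N \<subseteq> U \<and> emeasure lborel U
        \<le> ennreal (C * B ^ card S / (1 + \<kappa>) ^ N)"
      using as unfolding B_def by blast
    then obtain U where U: "\<And>N S. N0 \<le> N \<Longrightarrow> S \<subseteq> {..<N} \<Longrightarrow> real (card S) \<le> \<delta> * real N \<Longrightarrow>
        U N S \<in> sets borel \<and> fst ` single_orbits as M \<kappa> c R \<rho> S N \<subseteq> U N S \<and>
        emeasure lborel (U N S) \<le> ennreal (C * B ^ card S / (1 + \<kappa>) ^ N)"
      by (simp add: Bex_def) metis
    have "\<exists>V\<in>sets borel.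
        (\<forall>S\<subseteq>{..<N}. real (card S) \<le> \<delta> * real N \<longrightarrow> fst ` single_orbits as M \<kappa> c R \<rho> S N \<subseteq> V) \<and>
        emeasure lborel V \<le> ennreal (C * \<gamma> ^ N)" if N: "N0 \<le> N" for N
    proof -
      let ?I = "{S. S \<subseteq> {..<N} \<and> real (card S) \<le> \<delta> * real N}"
      have fin: "finite ?I"
        by (rule finite_subset[of _ "Pow {..<N}"]) auto
      have "emeasure lborel (\<Union>S\<in>?I. U N S) \<le> (\<Sum>S\<in>?I. emeasure lborel (U N S))"
        using U[OF N] fin by (intro emeasure_subadditive_finite) auto
      also have "\<dots> \<le> (\<Sum>S\<in>?I. ennreal (C * B ^ card S / (1 + \<kappa>) ^ N))"
        using U[OF N] by (intro sum_mono) auto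
      also have "\<dots> = ennreal (\<Sum>S\<in>?I. C * B ^ card S / (1 + \<kappa>) ^ N)"
        using C B assms by (intro sum_ennreal) auto
      also have "(\<Sum>S\<in>?I. C * B ^ card S / (1 + \<kappa>) ^ N) = C / (1 + \<kappa>) ^ N * (\<Sum>S\<in>?I. B ^ card S)"
        by (simp add: sum_distrib_left)
      also have "ennreal \<dots> \<le> ennreal (C / (1 + \<kappa>) ^ N * (\<tau> powr (- (\<delta> * real N)) * (1 + \<tau> * B) ^ N))"
        using sum_power_card_small_subsets_le[of "{..<N}" \<tau> B "\<delta> * real N"] C \<tau> B assms
        by (intro ennreal_leI mult_left_mono) auto
      also have "\<tau> powr (- (\<delta> * real N)) = (\<tau> powr (- \<delta>)) ^ N"
        using \<tau> by (simp add: powr_power mult.commute)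
      also have "C / (1 + \<kappa>) ^ N * ((\<tau> powr (- \<delta>)) ^ N * (1 + \<tau> * B) ^ N) = C * \<gamma> ^ N"
        by (simp add: \<gamma>_def power_divide power_mult_distrib)
      finally have "emeasure lborel (\<Union>S\<in>?I. U N S) \<le> ennreal (C * \<gamma> ^ N)" .
      moreover have "(\<Union>S\<in>?I. U N S) \<in> sets borel"
        using U[OF N] fin by (intro sets.finite_UN) auto
      moreover have "fst ` single_orbits as M \<kappa> c R \<rho> S N \<subseteq> (\<Union>S\<in>?I. U N S)"
        if "S \<subseteq> {..<N}" "real (card S) \<le> \<delta> * real N" for S
        using U[OF N that] that by blast
      ultimately show ?thesis by blast
    qed
    then show ?thesis using C by blast
  qed
  show ?thesis
  proof (rule exI[of _ \<rho>], rule exI[of _ \<delta>], intro conjI allI impI)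
    fix as and c R :: real
    assume "length as = D" "\<forall>a\<in>set as. \<bar>a\<bar> \<le> M" "c > 0" "R \<ge> 0"
    from core[OF this] \<gamma> show "\<exists>C\<ge>0. \<exists>\<gamma>\<ge>0. \<gamma> < 1 \<and> (\<exists>N0. \<forall>N\<ge>N0. \<exists>U\<in>sets borel.
        (\<forall>S\<subseteq>{..<N}. real (card S) \<le> \<delta> * real N \<longrightarrow> fst ` single_orbits as M \<kappa> c R \<rho> S N \<subseteq> U) \<and>
        emeasure lborel U \<le> ennreal (C * \<gamma> ^ N))"
      by meson
  qed (use \<rho> \<tau>(3) in auto)
qed

section \<open>Resonant parameters form a null set\<close>

text \<open>
  By translation invariance, the measure of \<open>B\<close> is the average over \<open>t \<in> [0, 1]\<close> of the measures of the translates
  \<open>B - t v\<close>. Exchanging the integrals gives an integral over the lines in direction \<open>v\<close>, for any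
  \<open>v\<close> and without a choice of coordinates.
\<close>
lemma null_set_if_null_on_lines:
  fixes B :: "'a::euclidean_space set"
  assumes B[measurable]: "B \<in> sets borel"
    and lines: "\<And>x. {t. x + t *\<^sub>R v \<in> B} \<in> null_sets lborel"
  shows "B \<in> null_sets lborel"
proof -
  have m[measurable]: "(\<lambda>(x, t). indicator {0..1} t * indicator B (x + t *\<^sub>R v) :: ennreal)
      \<in> borel_measurable (lborel \<Otimes>\<^sub>M lborel)"
    by (simp add: case_prod_beta' borel_prod cong: measurable_cong_sets)
  have shift: "(\<integral>\<^sup>+x. indicator B (x + c) \<partial>lborel) = emeasure lborel B" for c
  proof -
    have "emeasure lborel B = (\<integral>\<^sup>+x. indicator B x \<partial>distr lborel borel ((+) c))"
      by (simp add: lborel_distr_plus)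
    also have "\<dots> = (\<integral>\<^sup>+x. indicator B (x + c) \<partial>lborel)"
      by (subst nn_integral_distr) (auto simp: add.commute)
    finally show ?thesis by simp
  qed
  have "emeasure lborel B = (\<integral>\<^sup>+t. indicator {0..1::real} t * emeasure lborel B \<partial>lborel)"
    by (simp add: nn_integral_multc)
  also have "\<dots> = (\<integral>\<^sup>+t. \<integral>\<^sup>+x. indicator {0..1} t * indicator B (x + t *\<^sub>R v) \<partial>lborel \<partial>lborel)"
    by (simp add: nn_integral_cmult shift)
  also have "\<dots> = (\<integral>\<^sup>+x. \<integral>\<^sup>+t. indicator {0..1} t * indicator B (x + t *\<^sub>R v) \<partial>lborel \<partial>lborel)"
    by (rule lborel_pair.Fubini'[OF m])
  also have "\<dots> = (\<integral>\<^sup>+x. 0 \<partial>(lborel :: 'a measure))"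
  proof (rule nn_integral_cong)
    fix x :: 'a
    have "AE t in lborel. \<not> t \<in> {t. x + t *\<^sub>R v \<in> B}"
      using lines[of x] by (rule AE_not_in)
    then have "(\<integral>\<^sup>+t. indicator {0..1} t * indicator B (x + t *\<^sub>R v) \<partial>lborel) = (\<integral>\<^sup>+t. 0 \<partial>(lborel :: real measure))"
      by (intro nn_integral_cong_AE) (auto elim!: eventually_mono)
    then show "(\<integral>\<^sup>+t. indicator {0..1} t * indicator B (x + t *\<^sub>R v) \<partial>lborel) = 0"
      by simp
  qed
  finally show ?thesis by (simp add: null_sets_def)
qed

text \<open>
  Closeness to the integers is expressed by the cosine, which is continuous and is what appears in the modulus
  of a sum of two unit vectors.
\<close>
lemma dist_round_le_if_cos_ge:
  assumes "0 \<le> \<rho>" "\<rho> \<le> 1/2" "cos (2 * pi * \<rho>) \<le> cos (2 * pi * u)"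
  shows "\<bar>u - round u\<bar> \<le> \<rho>"
proof (rule ccontr)
  assume "\<not> \<bar>u - round u\<bar> \<le> \<rho>"
  moreover have "\<bar>u - round u\<bar> \<le> 1/2"
    using of_int_round_abs_le[of u] by (simp add: abs_minus_commute)
  ultimately have "cos (2 * pi * \<bar>u - round u\<bar>) < cos (2 * pi * \<rho>)"
    using assms by (intro cos_monotone_0_pi) auto
  also have "cos (2 * pi * \<bar>u - round u\<bar>) = cos (2 * pi * u)"
  proof -
    have "cos (2 * pi * \<bar>u - round u\<bar>) = cos \<bar>2 * pi * (u - round u)\<bar>"
      by (simp add: abs_mult)
    also have "\<dots> = cos (2 * pi * u - 2 * pi * of_int (round u))"
      by (simp only: cos_abs_real right_diff_distrib)
    also have "\<dots> = cos (2 * pi * u)"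
      by (simp add: cos_diff)
    finally show ?thesis .
  qed
  finally show False using assms(3) by simp
qed

definition orbit :: "real ^ 'n \<Rightarrow> real ^ 'n \<Rightarrow> nat \<Rightarrow> real" where
  "orbit \<theta> \<eta> n = (\<Sum>i\<in>UNIV. \<eta> $ i * \<theta> $ i ^ n)"

text \<open>
  The parameter \<open>J\<close> collects all constants: the coordinates of \<open>\<theta>\<close> and their differences are bounded in terms of \<open>J\<close>,
  and so are the coefficients \<open>\<eta>\<close>. It later runs through the natural numbers, which makes the exceptional set
  independent of digits and probabilities.
\<close>
definition resonant :: "'n \<Rightarrow> real \<Rightarrow> real \<Rightarrow> real \<Rightarrow> nat \<Rightarrow> (real ^ 'n) set" where
  "resonant k J \<rho> \<delta> N = {\<theta>.
     (\<forall>i. 1 + 1 / J \<le> \<bar>\<theta> $ i\<bar> \<and> \<bar>\<theta> $ i\<bar> \<le> J) \<and> (\<forall>i. i \<noteq> k \<longrightarrow> 1 / J \<le> \<bar>\<theta> $ k - \<theta> $ i\<bar>) \<and>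
     (\<exists>\<eta>. (\<forall>i. \<bar>\<eta> $ i\<bar> \<le> J) \<and> 1 / J \<le> \<bar>\<eta> $ k\<bar> \<and>
       (\<exists>S\<subseteq>{..<N}. real (card S) \<le> \<delta> * real N \<and>
         (\<forall>n\<in>{..<N} - S. cos (2 * pi * \<rho>) \<le> cos (2 * pi * orbit \<theta> \<eta> n))))}"

text \<open>
  For each of the finitely many \<open>S\<close>, the pairs \<open>(\<theta>, \<eta>)\<close> that satisfy the conditions form a compact set, and the projection
  of a compact set is compact.
\<close>
lemma borel_resonant: "resonant k J \<rho> \<delta> N \<in> sets (borel :: (real ^ 'n) measure)"
proof -
  let ?I = "{S. S \<subseteq> {..<N} \<and> real (card S) \<le> \<delta> * real N}"
  define Q where "Q S = {p :: (real ^ 'n) \<times> (real ^ 'n).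
     (\<forall>i. 1 + 1 / J \<le> \<bar>fst p $ i\<bar> \<and> \<bar>fst p $ i\<bar> \<le> J) \<and>
     (\<forall>i. i \<noteq> k \<longrightarrow> 1 / J \<le> \<bar>fst p $ k - fst p $ i\<bar>) \<and>
     (\<forall>i. \<bar>snd p $ i\<bar> \<le> J) \<and> 1 / J \<le> \<bar>snd p $ k\<bar> \<and>
     (\<forall>n. n \<in> {..<N} - S \<longrightarrow> cos (2 * pi * \<rho>) \<le> cos (2 * pi * orbit (fst p) (snd p) n))}" for S
  have "compact (Q S)" for S
  proof -
    have "closed (Q S)"
      unfolding Q_def orbit_def
      by (intro closed_Collect_conj closed_Collect_all closed_Collect_imp open_Collect_const
          closed_Collect_le continuous_intros)
    moreover have "Q S \<subseteq> cbox (\<chi> i. - J) (\<chi> i. J) \<times> cbox (\<chi> i. - J) (\<chi> i. J)"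
      unfolding Q_def by (auto simp: mem_box_cart abs_le_iff minus_le_iff)
    moreover have "compact (cbox (\<chi> i. - J) (\<chi> i. J) \<times> cbox (\<chi> i. - J) (\<chi> i. J) :: ((real ^ 'n) \<times> (real ^ 'n)) set)"
      by (intro compact_Times compact_cbox)
    ultimately show ?thesis
      by (metis bounded_subset compact_eq_bounded_closed)
  qed
  then have "closed (fst ` Q S)" for S
    by (intro compact_imp_closed compact_continuous_image continuous_intros)
  moreover have "finite ?I"
    by (rule finite_subset[of _ "Pow {..<N}"]) auto
  moreover have "resonant k J \<rho> \<delta> N = (\<Union>S\<in>?I. fst ` Q S)"
  proof (intro set_eqI iffI)
    fix \<theta> :: "real ^ 'n" assume "\<theta> \<in> resonant k J \<rho> \<delta> N"
    then obtain \<eta> S where "(\<forall>i. 1 + 1 / J \<le> \<bar>\<theta> $ i\<bar> \<and> \<bar>\<theta> $ i\<bar> \<le> J)"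
      "(\<forall>i. i \<noteq> k \<longrightarrow> 1 / J \<le> \<bar>\<theta> $ k - \<theta> $ i\<bar>)" "\<forall>i. \<bar>\<eta> $ i\<bar> \<le> J" "1 / J \<le> \<bar>\<eta> $ k\<bar>" and S: "S \<in> ?I"
      and "\<forall>n\<in>{..<N} - S. cos (2 * pi * \<rho>) \<le> cos (2 * pi * orbit \<theta> \<eta> n)"
      unfolding resonant_def by blast
    then have "(\<theta>, \<eta>) \<in> Q S"
      unfolding Q_def by simp
    then have "\<theta> \<in> fst ` Q S"
      by (rule image_eqI[rotated]) simp
    then show "\<theta> \<in> (\<Union>S\<in>?I. fst ` Q S)"
      using S by blast
  next
    fix \<theta> :: "real ^ 'n" assume "\<theta> \<in> (\<Union>S\<in>?I. fst ` Q S)"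
    then obtain \<eta> S where "S \<in> ?I" "(\<theta>, \<eta>) \<in> Q S" by auto
    then show "\<theta> \<in> resonant k J \<rho> \<delta> N"
      unfolding resonant_def Q_def by simp blast
  qed
  ultimately show ?thesis
    by (auto intro!: sets.finite_UN)
qed


text \<open>
  Applying the operators for all \<open>j \<noteq> k\<close> leaves only the \<open>k\<close>-th exponential, with the coefficient
  \<open>\<eta>\<^sub>k \<Prod>\<^sub>j (\<theta>\<^sub>k - \<theta>\<^sub>j)\<close>. Separation of the coordinates bounds it from below.
\<close>
lemma orbit_in_single_orbits:
  fixes \<theta> \<eta> :: "real ^ 'n"
  assumes js: "set js = UNIV - {k}" "distinct js" and "J \<ge> 1"
    and \<theta>: "\<And>i. 1 + 1 / J \<le> \<bar>\<theta> $ i\<bar>" "\<And>i. \<bar>\<theta> $ i\<bar> \<le> J" "\<And>i. i \<noteq> k \<Longrightarrow> 1 / J \<le> \<bar>\<theta> $ k - \<theta> $ i\<bar>"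
    and \<eta>: "\<And>i. \<bar>\<eta> $ i\<bar> \<le> J" "1 / J \<le> \<bar>\<eta> $ k\<bar>"
    and \<rho>: "0 \<le> \<rho>" "\<rho> \<le> 1/2"
    and cos: "\<And>n. n \<in> {..<N} - S \<Longrightarrow> cos (2 * pi * \<rho>) \<le> cos (2 * pi * orbit \<theta> \<eta> n)"
  shows "(\<theta> $ k, orbit \<theta> \<eta>) \<in> single_orbits (map (($) \<theta>) js) J (1 / J)
    ((1 / J) ^ Suc (length js)) (real CARD('n) * J) \<rho> S N"
proof -
  define y where "y = \<eta> $ k * (\<Prod>j\<leftarrow>js. \<theta> $ k - \<theta> $ j)"
  have "annihilate (map (($) \<theta>) js) (orbit \<theta> \<eta>) n = y * \<theta> $ k ^ n" for n
  proof -
    have "annihilate (map (($) \<theta>) js) (orbit \<theta> \<eta>) n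
        = (\<Sum>i\<in>UNIV. \<eta> $ i * (\<Prod>j\<leftarrow>js. \<theta> $ i - \<theta> $ j) * \<theta> $ i ^ n)"
      using annihilate_exponential_sum[of "map (($) \<theta>) js" "($) \<eta>" "($) \<theta>" UNIV n]
      unfolding orbit_def[abs_def] by (simp add: comp_def)
    also have "\<dots> = (\<Sum>i\<in>UNIV. if i = k then y * \<theta> $ k ^ n else 0)"
    proof (rule sum.cong)
      fix i
      have "(\<Prod>j\<leftarrow>js. \<theta> $ i - \<theta> $ j) = 0" if "i \<noteq> k"
        using js(1) that by (auto simp: prod_list_zero_iff image_iff)
      then show "\<eta> $ i * (\<Prod>j\<leftarrow>js. \<theta> $ i - \<theta> $ j) * \<theta> $ i ^ n = (if i = k then y * \<theta> $ k ^ n else 0)"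
        by (simp add: y_def)
    qed simp
    finally show ?thesis by simp
  qed
  moreover have "(1 / J) ^ Suc (length js) \<le> \<bar>y\<bar>"
  proof -
    have "(1 / J) ^ length l \<le> \<bar>\<Prod>j\<leftarrow>l. \<theta> $ k - \<theta> $ j\<bar>" if "set l \<subseteq> UNIV - {k}" for l
      using that
    proof (induction l)
      case (Cons j l)
      then have "1 / J * (1 / J) ^ length l \<le> \<bar>\<theta> $ k - \<theta> $ j\<bar> * \<bar>\<Prod>j\<leftarrow>l. \<theta> $ k - \<theta> $ j\<bar>"
        using \<theta>(3) \<open>J \<ge> 1\<close> by (intro mult_mono) auto
      then show ?case by (simp add: abs_mult)
    qed simp
    from this[of js] have "1 / J * (1 / J) ^ length js \<le> \<bar>\<eta> $ k\<bar> * \<bar>\<Prod>j\<leftarrow>js. \<theta> $ k - \<theta> $ j\<bar>"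
      using js \<eta>(2) \<open>J \<ge> 1\<close> by (intro mult_mono) auto
    then show ?thesis by (simp add: y_def abs_mult)
  qed
  moreover have "\<bar>orbit \<theta> \<eta> n\<bar> \<le> real CARD('n) * J * J ^ n" for n
  proof -
    have "\<bar>orbit \<theta> \<eta> n\<bar> \<le> (\<Sum>i\<in>UNIV. \<bar>\<eta> $ i * \<theta> $ i ^ n\<bar>)"
      unfolding orbit_def by (rule sum_abs)
    also have "\<dots> \<le> (\<Sum>i\<in>(UNIV :: 'n set). J * J ^ n)"
      unfolding abs_mult power_abs using \<eta> \<theta> \<open>J \<ge> 1\<close>
      by (intro sum_mono mult_mono power_mono) auto
    finally show ?thesis by simp
  qed
  moreover have "\<bar>orbit \<theta> \<eta> n - round (orbit \<theta> \<eta> n)\<bar> \<le> \<rho>" if "n \<in> {..<N} - S" for n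
    using cos[OF that] \<rho> by (intro dist_round_le_if_cos_ge) auto
  ultimately show ?thesis
    using \<theta> unfolding single_orbits_def by auto
qed

text \<open>
  On a line parallel to the \<open>k\<close>-th axis only \<open>\<theta>\<^sub>k\<close> varies, so the list of the other ratios is constant and
  \<open>erdos_kahane\<close> with the lemma of Borel and Cantelli applies.
\<close>
lemma limsup_resonant_null:
  assumes "J > 1"
  shows "\<exists>\<rho> \<delta>. 0 < \<rho> \<and> \<rho> < 1/2 \<and> 0 < \<delta> \<and>
    (\<forall>k. limsup (resonant k J \<rho> \<delta>) \<in> null_sets (lborel :: (real ^ 'n) measure))"
proof -
  have "1 / J > 0" "J \<ge> 1" using assms by auto
  from erdos_kahane[OF this, of "CARD('n) - 1"] obtain \<rho> \<delta>
    where \<rho>: "0 < \<rho>" "\<rho> < 1/2" "0 < \<delta>"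
    and EK: "\<forall>as c R. length as = CARD('n) - 1 \<longrightarrow> (\<forall>a\<in>set as. \<bar>a\<bar> \<le> J) \<longrightarrow> c > 0 \<longrightarrow> R \<ge> 0 \<longrightarrow>
      (\<exists>C\<ge>0. \<exists>\<gamma>\<ge>0. \<gamma> < 1 \<and> (\<exists>N0. \<forall>N\<ge>N0. \<exists>U\<in>sets borel.
        (\<forall>S\<subseteq>{..<N}. real (card S) \<le> \<delta> * real N \<longrightarrow>
          fst ` single_orbits as J (1 / J) c R \<rho> S N \<subseteq> U) \<and>
        emeasure lborel U \<le> ennreal (C * \<gamma> ^ N)))"
    by (elim exE conjE) (rule that)
  have "limsup (resonant k J \<rho> \<delta>) \<in> null_sets (lborel :: (real ^ 'n) measure)" for k
  proof (rule null_set_if_null_on_lines[where v = "axis k 1"])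
    note borel_resonant[measurable]
    show "limsup (resonant k J \<rho> \<delta>) \<in> sets (borel :: (real ^ 'n) measure)"
      by measurable
    fix x :: "real ^ 'n"
    define A where "A N = {t. x + t *\<^sub>R axis k 1 \<in> resonant k J \<rho> \<delta> N}" for N
    have A_limsup: "{t. x + t *\<^sub>R axis k 1 \<in> limsup (resonant k J \<rho> \<delta>)} = limsup A"
      by (auto simp: mem_limsup_iff A_def)
    have A_sets: "A N \<in> sets lborel" for N
    proof -
      have "(\<lambda>t. x + t *\<^sub>R axis k 1) -` resonant k J \<rho> \<delta> N \<inter> space borel \<in> sets borel"
        by (rule measurable_sets[OF _ borel_resonant]) measurable
      then show ?thesis by (simp add: A_def vimage_def)
    qed
    have A_bounded: "A N \<subseteq> {- J - x $ k..J - x $ k}" for N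
      unfolding A_def resonant_def by (auto simp: axis_def dest!: spec[of _ k])
    show "{t. x + t *\<^sub>R axis k 1 \<in> limsup (resonant k J \<rho> \<delta>)} \<in> null_sets lborel"
    proof (cases "\<forall>i. i \<noteq> k \<longrightarrow> \<bar>x $ i\<bar> \<le> J")
      case False
      then have "A N = {}" for N
        unfolding A_def resonant_def by (auto simp: axis_def)
      then have "limsup A = {}"
        by (auto simp: mem_limsup_iff)
      then show ?thesis by (simp add: A_limsup)
    next
      case True
      obtain js where js: "set js = UNIV - {k}" "distinct js"
        using finite_distinct_list[of "UNIV - {k}"] by auto
      have len: "length js = CARD('n) - 1"
        using js distinct_card[of js] by (simp add: card_Diff_singleton)
      define as where "as = map (($) x) js"
      have "length as = CARD('n) - 1" "\<forall>a\<in>set as. \<bar>a\<bar> \<le> J" "(1 / J) ^ Suc (length js) > 0"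
        "real CARD('n) * J \<ge> 0"
        using js True len assms by (auto simp: as_def)
      from EK[THEN spec, THEN spec, THEN spec, THEN mp, THEN mp, THEN mp, THEN mp, OF this] obtain C \<gamma> N0 where C: "C \<ge> 0" "\<gamma> \<ge> 0" "\<gamma> < 1"
        and "\<forall>N\<ge>N0. \<exists>U\<in>sets borel. (\<forall>S\<subseteq>{..<N}. real (card S) \<le> \<delta> * real N \<longrightarrow>
          fst ` single_orbits as J (1 / J) ((1 / J) ^ Suc (length js)) (real CARD('n) * J) \<rho> S N \<subseteq> U) \<and>
          emeasure lborel U \<le> ennreal (C * \<gamma> ^ N)"
        by blast
      then obtain U where U: "\<And>N. N \<ge> N0 \<Longrightarrow> U N \<in> sets borel"
        "\<And>N S. N \<ge> N0 \<Longrightarrow> S \<subseteq> {..<N} \<Longrightarrow> real (card S) \<le> \<delta> * real N \<Longrightarrow>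
          fst ` single_orbits as J (1 / J) ((1 / J) ^ Suc (length js)) (real CARD('n) * J) \<rho> S N \<subseteq> U N"
        "\<And>N. N \<ge> N0 \<Longrightarrow> emeasure lborel (U N) \<le> ennreal (C * \<gamma> ^ N)"
        by metis
      have A_le: "emeasure lborel (A N) \<le> ennreal (C * \<gamma> ^ N)" if N: "N \<ge> N0" for N
      proof -
        have "A N \<subseteq> (+) (x $ k) -` U N"
        proof
          fix t assume "t \<in> A N"
          define \<theta> where "\<theta> = x + t *\<^sub>R axis k 1"
          have \<theta>k: "\<theta> $ k = x $ k + t" and \<theta>i: "\<And>i. i \<noteq> k \<Longrightarrow> \<theta> $ i = x $ i"
            by (auto simp: \<theta>_def axis_def)
          have "\<theta> \<in> resonant k J \<rho> \<delta> N"
            using \<open>t \<in> A N\<close> by (simp add: A_def \<theta>_def)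
          then obtain \<eta> S where \<eta>: "\<And>i. 1 + 1 / J \<le> \<bar>\<theta> $ i\<bar>" "\<And>i. \<bar>\<theta> $ i\<bar> \<le> J"
            "\<And>i. i \<noteq> k \<Longrightarrow> 1 / J \<le> \<bar>\<theta> $ k - \<theta> $ i\<bar>" "\<And>i. \<bar>\<eta> $ i\<bar> \<le> J" "1 / J \<le> \<bar>\<eta> $ k\<bar>"
            "\<And>n. n \<in> {..<N} - S \<Longrightarrow> cos (2 * pi * \<rho>) \<le> cos (2 * pi * orbit \<theta> \<eta> n)"
            and S: "S \<subseteq> {..<N}" "real (card S) \<le> \<delta> * real N"
            unfolding resonant_def by blast
          have "map (($) \<theta>) js = as"
            unfolding as_def using js(1) \<theta>i by auto
          moreover have "(\<theta> $ k, orbit \<theta> \<eta>) \<in> single_orbits (map (($) \<theta>) js) J (1 / J)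
              ((1 / J) ^ Suc (length js)) (real CARD('n) * J) \<rho> S N"
            by (rule orbit_in_single_orbits) (use js \<eta> \<rho> assms in auto)
          ultimately have "\<theta> $ k \<in> U N"
            using U(2)[OF N S] by force
          then show "t \<in> (+) (x $ k) -` U N"
            by (simp add: \<theta>k)
        qed
        then have "emeasure lborel (A N) \<le> emeasure lborel ((+) (x $ k) -` U N \<inter> space lborel)"
          using U(1)[OF N] by (intro emeasure_mono) (auto intro!: measurable_sets_borel)
        also have "\<dots> = emeasure (distr lborel borel ((+) (x $ k))) (U N)"
          using U(1)[OF N] by (subst emeasure_distr) auto
        also have "\<dots> = emeasure lborel (U N)"
          by (simp add: lborel_distr_plus)
        finally show ?thesis using U(3)[OF N] by simp
      qed
      have "limsup A \<in> null_sets lborel"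
      proof (rule borel_cantelli_limsup1[OF A_sets])
        show "emeasure lborel (A N) < \<infinity>" for N
        proof -
          have "emeasure lborel (A N) \<le> emeasure lborel {- J - x $ k..J - x $ k}"
            by (rule emeasure_mono[OF A_bounded]) simp
          also have "\<dots> < \<infinity>"
            using assms by simp
          finally show ?thesis .
        qed
        show "summable (\<lambda>N. measure lborel (A N))"
        proof (rule summable_comparison_test'[of "\<lambda>N. C * \<gamma> ^ N" N0])
          show "summable (\<lambda>N. C * \<gamma> ^ N)"
            using C by (intro summable_mult summable_geometric) auto
          show "norm (measure lborel (A N)) \<le> C * \<gamma> ^ N" if "N \<ge> N0" for N
            using A_le[OF that] C by (simp add: measure_def enn2real_leI)
        qed
      qed
      then show ?thesis by (simp add: A_limsup)
    qed
  qed
  then show ?thesis using \<rho> by blast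
qed

section \<open>Existence and uniqueness of self-affine measures\<close>

lemma contraction_matrix_component:
  "(contraction_matrix \<theta> *v x) $ i = x $ i / \<theta> $ i"
proof -
  have "(contraction_matrix \<theta> *v x) $ i = (\<Sum>j\<in>UNIV. (if i = j then inverse (\<theta> $ i) else 0) * x $ j)"
    unfolding contraction_matrix_def matrix_vector_mult_def by simp
  also have "\<dots> = (\<Sum>j\<in>UNIV. if i = j then inverse (\<theta> $ i) * x $ j else 0)"
    by (intro sum.cong) auto
  finally show ?thesis by (simp add: divide_inverse)
qed

lemma contraction_power_component:
  "((\<lambda>x. contraction_matrix \<theta> *v x) ^^ n) x $ i = x $ i / \<theta> $ i ^ n"
  by (induction n) (auto simp: contraction_matrix_component)

lemma inner_contraction_commute:
  "\<xi> \<bullet> (contraction_matrix \<theta> *v x) = (contraction_matrix \<theta> *v \<xi>) \<bullet> x"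
  unfolding inner_vec_def by (simp add: contraction_matrix_component)

lemma contraction_factor:
  fixes \<theta> :: "real ^ 'n"
  assumes "\<forall>j. \<bar>\<theta> $ j\<bar> > 1"
  shows "\<exists>r. 0 \<le> r \<and> r < 1 \<and> (\<forall>x. norm (contraction_matrix \<theta> *v x) \<le> r * norm x)"
proof -
  define r where "r = Max (range (\<lambda>i. 1 / \<bar>\<theta> $ i\<bar>))"
  have r: "1 / \<bar>\<theta> $ i\<bar> \<le> r" for i
    unfolding r_def by (intro Max_ge) auto
  have "r \<in> range (\<lambda>i. 1 / \<bar>\<theta> $ i\<bar>)"
    unfolding r_def by (intro Max_in) auto
  then obtain i where i: "r = 1 / \<bar>\<theta> $ i\<bar>" by auto
  have "\<bar>\<theta> $ i\<bar> > 1" using assms by blast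
  then have r01: "0 \<le> r" "r < 1" by (auto simp: i)
  have "norm (contraction_matrix \<theta> *v x) \<le> norm (r *\<^sub>R x)" for x
  proof (rule norm_le_componentwise_cart)
    fix i
    have "\<bar>x $ i\<bar> * (1 / \<bar>\<theta> $ i\<bar>) \<le> \<bar>x $ i\<bar> * r"
      using r[of i] by (intro mult_left_mono) auto
    then show "norm ((contraction_matrix \<theta> *v x) $ i) \<le> norm ((r *\<^sub>R x) $ i)"
      using r01 by (simp add: contraction_matrix_component abs_mult mult.commute)
  qed
  then show ?thesis using r01 by auto
qed

lemma contraction_power_norm:
  assumes "0 \<le> r" "\<And>x. norm (contraction_matrix \<theta> *v x) \<le> r * norm x"
  shows "norm (((\<lambda>x. contraction_matrix \<theta> *v x) ^^ n) x) \<le> r ^ n * norm x"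
proof (induction n)
  case (Suc n)
  have "norm (((\<lambda>x. contraction_matrix \<theta> *v x) ^^ Suc n) x) \<le> r * (r ^ n * norm x)"
    using assms(2)[of "((\<lambda>x. contraction_matrix \<theta> *v x) ^^ n) x"] Suc assms(1)
    by simp (meson mult_left_mono order_trans)
  then show ?case by (simp add: mult.assoc)
qed simp

lemma summable_contraction_series:
  fixes b :: "nat \<Rightarrow> real ^ 'n"
  assumes "\<forall>j. \<bar>\<theta> $ j\<bar> > 1" "\<And>n. norm (b n) \<le> B"
  shows "summable (\<lambda>n. ((\<lambda>x. contraction_matrix \<theta> *v x) ^^ n) (b n))"
proof -
  obtain r where r: "0 \<le> r" "r < 1" "\<And>x. norm (contraction_matrix \<theta> *v x) \<le> r * norm x"
    using contraction_factor[OF assms(1)] by blast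
  show ?thesis
  proof (rule summable_comparison_test'[of "\<lambda>n. r ^ n * B" 0])
    show "summable (\<lambda>n. r ^ n * B)"
      using r by (intro summable_mult2 summable_geometric) auto
    fix n
    have "norm (((\<lambda>x. contraction_matrix \<theta> *v x) ^^ n) (b n)) \<le> r ^ n * norm (b n)"
      using contraction_power_norm[of r \<theta> n "b n"] r by blast
    also have "\<dots> \<le> r ^ n * B"
      using assms(2) r by (intro mult_left_mono) auto
    finally show "norm (((\<lambda>x. contraction_matrix \<theta> *v x) ^^ n) (b n)) \<le> r ^ n * B" .
  qed
qed

lemma continuous_on_ifs_map[continuous_intros]: "continuous_on S (ifs_map \<theta> b)"
  unfolding ifs_map_def[abs_def] by (intro continuous_intros)

lemma measurable_ifs_map[measurable]: "ifs_map \<theta> b \<in> borel_measurable borel"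
  by (intro borel_measurable_continuous_onI continuous_intros)

lemma emeasure_distr_pmf_pair:
  fixes P :: "'a pmf" and g :: "'a \<times> 'b \<Rightarrow> 'c"
  assumes "prob_space N" and g: "g \<in> measure_pmf P \<Otimes>\<^sub>M N \<rightarrow>\<^sub>M L"
    and A: "finite A" "set_pmf P \<subseteq> A" and B: "B \<in> sets L"
  shows "emeasure (distr (measure_pmf P \<Otimes>\<^sub>M N) L g) B
    = (\<Sum>j\<in>A. ennreal (pmf P j) * emeasure N {y \<in> space N. g (j, y) \<in> B})"
proof -
  interpret N: prob_space N by fact
  have "emeasure (distr (measure_pmf P \<Otimes>\<^sub>M N) L g) B
      = (\<integral>\<^sup>+j. emeasure N (Pair j -` (g -` B \<inter> space (measure_pmf P \<Otimes>\<^sub>M N))) \<partial>measure_pmf P)"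
    using g B by (simp add: emeasure_distr N.emeasure_pair_measure_alt measurable_sets)
  also have "\<dots> = (\<integral>\<^sup>+j. emeasure N {y \<in> space N. g (j, y) \<in> B} \<partial>measure_pmf P)"
    by (intro nn_integral_cong arg_cong2[of _ _ _ _ emeasure]) (auto simp: space_pair_measure)
  also have "\<dots> = (\<Sum>j\<in>A. emeasure N {y \<in> space N. g (j, y) \<in> B} * pmf P j)"
    using A by (intro nn_integral_measure_pmf_support) (auto simp: pmf_eq_0_set_pmf)
  finally show ?thesis by (simp add: mult.commute)
qed

lemma exists_pmf_on_digits:
  fixes p :: "nat \<Rightarrow> real"
  assumes "\<forall>j\<in>{1..m}. p j > 0" "(\<Sum>j=1..m. p j) = 1"
  shows "\<exists>P. set_pmf P \<subseteq> {1..m} \<and> (\<forall>j\<in>{1..m}. pmf P j = p j)"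
proof -
  define q where "q j = (if j \<in> {1..m} then p j else 0)" for j
  have q0: "0 \<le> q j" for j
    using assms(1) by (auto simp: q_def less_imp_le)
  have "(\<integral>\<^sup>+j. ennreal (q j) \<partial>count_space UNIV) = (\<integral>\<^sup>+j. ennreal (p j) * indicator {1..m} j \<partial>count_space UNIV)"
    by (intro nn_integral_cong) (auto simp: q_def)
  also have "\<dots> = (\<Sum>j\<in>{1..m}. ennreal (p j))"
    by (simp add: nn_integral_count_space_indicator[symmetric] nn_integral_count_space_finite)
  also have "\<dots> = 1"
    using assms by (subst sum_ennreal) (auto intro: less_imp_le)
  finally have "pmf (embed_pmf q) j = q j" for j
    using q0 by (intro pmf_embed_pmf) auto
  then show ?thesis
    by (intro exI[of _ "embed_pmf q"]) (auto simp: set_pmf_iff q_def split: if_splits)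
qed

text \<open>
  Self-affinity is the statement that \<open>\<mu>\<close> is the law of \<open>A x + a\<^sub>j\<close> for independent \<open>j\<close> and \<open>x\<close>, where \<open>x\<close>
  has law \<open>\<mu>\<close>. In this form it passes from sets to integrals by Fubini's theorem.
\<close>
lemma self_affine_measure_eq_distr:
  assumes \<mu>: "is_self_affine_measure \<theta> m a p \<mu>"
    and P: "set_pmf P \<subseteq> {1..m}" "\<forall>j\<in>{1..m}. pmf P j = p j"
  shows "(\<lambda>(j, x). ifs_map \<theta> (a j) x) \<in> measure_pmf P \<Otimes>\<^sub>M \<mu> \<rightarrow>\<^sub>M borel"
    and "distr (measure_pmf P \<Otimes>\<^sub>M \<mu>) borel (\<lambda>(j, x). ifs_map \<theta> (a j) x) = \<mu>"
proof -
  interpret prob_space \<mu>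
    using \<mu> by (simp add: is_self_affine_measure_def)
  have sets[measurable_cong]: "sets \<mu> = sets borel"
    using \<mu> by (simp add: is_self_affine_measure_def)
  then have space: "space \<mu> = UNIV"
    by (auto dest: sets_eq_imp_space_eq)
  show m: "(\<lambda>(j, x). ifs_map \<theta> (a j) x) \<in> measure_pmf P \<Otimes>\<^sub>M \<mu> \<rightarrow>\<^sub>M borel"
    unfolding ifs_map_def[abs_def] case_prod_beta'
    by (intro borel_measurable_add measurable_compose[OF measurable_snd]
        measurable_compose[OF measurable_fst])
      (auto simp: sets cong: measurable_cong_sets intro!: borel_measurable_continuous_onI continuous_intros)
  show "distr (measure_pmf P \<Otimes>\<^sub>M \<mu>) borel (\<lambda>(j, x). ifs_map \<theta> (a j) x) = \<mu>"
  proof (rule measure_eqI)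
    fix B assume "B \<in> sets (distr (measure_pmf P \<Otimes>\<^sub>M \<mu>) borel (\<lambda>(j, x). ifs_map \<theta> (a j) x))"
    then have B: "B \<in> sets borel" by simp
    have "emeasure (distr (measure_pmf P \<Otimes>\<^sub>M \<mu>) borel (\<lambda>(j, x). ifs_map \<theta> (a j) x)) B
        = (\<Sum>j=1..m. ennreal (pmf P j) * emeasure \<mu> (ifs_map \<theta> (a j) -` B))"
      using emeasure_distr_pmf_pair[OF prob_space_axioms m _ P(1) B]
      by (simp add: space vimage_def)
    also have "\<dots> = ennreal (\<Sum>j=1..m. pmf P j * measure \<mu> (ifs_map \<theta> (a j) -` B))"
      by (simp add: emeasure_eq_measure ennreal_mult' sum_ennreal[symmetric])
    also have "\<dots> = emeasure \<mu> B"
      using \<mu> B P(2) unfolding is_self_affine_measure_def by (simp add: emeasure_eq_measure)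
    finally show "emeasure (distr (measure_pmf P \<Otimes>\<^sub>M \<mu>) borel (\<lambda>(j, x). ifs_map \<theta> (a j) x)) B
        = emeasure \<mu> B" .
  qed (simp add: sets)
qed

lemma integral_self_affine:
  fixes f :: "real ^ 'n \<Rightarrow> 'b::{banach, second_countable_topology}"
  assumes \<mu>: "is_self_affine_measure \<theta> m a p \<mu>"
    and p: "\<forall>j\<in>{1..m}. p j > 0" "(\<Sum>j=1..m. p j) = 1"
    and f: "f \<in> borel_measurable borel" "\<And>x. norm (f x) \<le> c"
  shows "(\<integral>x. f x \<partial>\<mu>) = (\<Sum>j=1..m. p j *\<^sub>R (\<integral>x. f (ifs_map \<theta> (a j) x) \<partial>\<mu>))"
proof -
  obtain P where P: "set_pmf P \<subseteq> {1..m}" "\<forall>j\<in>{1..m}. pmf P j = p j"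
    using exists_pmf_on_digits[OF p] by (elim exE conjE) (rule that)
  note eq = self_affine_measure_eq_distr[OF \<mu> P]
  interpret prob_space \<mu>
    using \<mu> by (simp add: is_self_affine_measure_def)
  interpret pair_prob_space "measure_pmf P" \<mu>
    by unfold_locales
  let ?g = "\<lambda>(j, x). ifs_map \<theta> (a j) x"
  have int: "integrable (measure_pmf P \<Otimes>\<^sub>M \<mu>) (\<lambda>z. f (?g z))"
  proof (rule P.integrable_const_bound[where B = c])
    show "(\<lambda>z. f (?g z)) \<in> borel_measurable (measure_pmf P \<Otimes>\<^sub>M \<mu>)"
      using eq(1) f(1) by (rule measurable_compose)
  qed (use f(2) in simp)
  have "(\<integral>x. f x \<partial>\<mu>) = (\<integral>x. f x \<partial>distr (measure_pmf P \<Otimes>\<^sub>M \<mu>) borel ?g)"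
    by (simp only: eq(2))
  also have "\<dots> = (\<integral>z. f (?g z) \<partial>(measure_pmf P \<Otimes>\<^sub>M \<mu>))"
    using eq(1) f(1) by (rule integral_distr)
  also have "\<dots> = (\<integral>j. (\<integral>x. f (ifs_map \<theta> (a j) x) \<partial>\<mu>) \<partial>measure_pmf P)"
    using integral_fst'[OF int] by simp
  also have "\<dots> = (\<Sum>j=1..m. pmf P j *\<^sub>R (\<integral>x. f (ifs_map \<theta> (a j) x) \<partial>\<mu>))"
    using P(1) by (intro integral_measure_pmf) auto
  also have "\<dots> = (\<Sum>j=1..m. p j *\<^sub>R (\<integral>x. f (ifs_map \<theta> (a j) x) \<partial>\<mu>))"
    using P(2) by (intro sum.cong) auto
  finally show ?thesis .
qed

text \<open>
  The measure is the law of the random series \<open>\<Sum>\<^sub>n A\<^sup>n b\<^sub>n\<close> with independent digits. Splitting off the first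
  digit gives an independent copy of the series, hence self-affinity.
\<close>
lemma exists_self_affine_measure:
  fixes \<theta> :: "real ^ 'n"
  assumes \<theta>: "\<forall>j. \<bar>\<theta> $ j\<bar> > 1"
    and p: "\<forall>j\<in>{1..m}. p j > 0" "(\<Sum>j=1..m. p j) = 1"
  shows "\<exists>\<mu>. is_self_affine_measure \<theta> m a p \<mu>"
proof -
  obtain P where digits: "set_pmf P \<subseteq> {1..m}" "\<forall>j\<in>{1..m}. pmf P j = p j"
    using exists_pmf_on_digits[OF p] by (elim exE conjE) (rule that)
  interpret sequence_space "measure_pmf P"
    by unfold_locales
  let ?A = "\<lambda>x. contraction_matrix \<theta> *v x"
  \<comment> \<open>Indices outside \<open>{1..m}\<close> have probability 0, but the series must converge for them too.\<close>
  define b where "b j = (if j \<in> {1..m} then a j else 0)" for j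
  define B where "B = (\<Sum>j=1..m. norm (a j))"
  have b: "norm (b j) \<le> B" for j
    unfolding b_def B_def by (auto intro: member_le_sum sum_nonneg)
  define X where "X \<omega> = (\<Sum>n. (?A ^^ n) (b (\<omega> n)))" for \<omega> :: "nat \<Rightarrow> nat"
  have summ: "summable (\<lambda>n. (?A ^^ n) (b (\<omega> n)))" for \<omega> :: "nat \<Rightarrow> nat"
    using \<theta> b by (rule summable_contraction_series)
  have X_meas[measurable]: "X \<in> borel_measurable S"
    unfolding X_def[abs_def]
  proof (rule borel_measurable_suminf)
    fix n
    have "(\<lambda>\<omega>. \<omega> n) \<in> S \<rightarrow>\<^sub>M measure_pmf P"
      by (rule measurable_component_singleton) simp
    then show "(\<lambda>\<omega>. (?A ^^ n) (b (\<omega> n))) \<in> borel_measurable S"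
      by (rule measurable_compose) simp
  qed
  have X_cons: "X (case_nat j \<omega>) = ifs_map \<theta> (b j) (X \<omega>)" for j \<omega>
  proof -
    have "X (case_nat j \<omega>) = (\<Sum>n. (?A ^^ Suc n) (b (\<omega> n))) + b j"
      unfolding X_def using suminf_split_head[OF summ[of "case_nat j \<omega>"]] by simp
    also have "(\<Sum>n. (?A ^^ Suc n) (b (\<omega> n))) = ?A (X \<omega>)"
      unfolding X_def using bounded_linear.suminf[OF matrix_vector_mul_bounded_linear[of "contraction_matrix \<theta>"] summ[of \<omega>]]
      by simp
    finally show ?thesis by (simp add: ifs_map_def)
  qed
  define \<mu> where "\<mu> = distr S borel X"
  have "measure \<mu> D = (\<Sum>j=1..m. p j * measure \<mu> (ifs_map \<theta> (a j) -` D))" if D: "D \<in> sets borel" for D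
  proof -
    let ?c = "\<lambda>(s, \<omega>). case_nat s \<omega>"
    have c: "?c \<in> measure_pmf P \<Otimes>\<^sub>M S \<rightarrow>\<^sub>M S"
      by measurable
    have m: "(\<lambda>z. X (?c z)) \<in> borel_measurable (measure_pmf P \<Otimes>\<^sub>M S)"
      using c X_meas by (rule measurable_compose)
    have "\<mu> = distr (distr (measure_pmf P \<Otimes>\<^sub>M S) S ?c) borel X"
      unfolding \<mu>_def PiM_iter ..
    also have "\<dots> = distr (measure_pmf P \<Otimes>\<^sub>M S) borel (\<lambda>z. X (?c z))"
      using c X_meas by (simp add: distr_distr comp_def)
    finally have "emeasure \<mu> D
        = (\<Sum>j=1..m. ennreal (pmf P j) * emeasure S {\<omega> \<in> space S. X (?c (j, \<omega>)) \<in> D})"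
      using emeasure_distr_pmf_pair[OF P.prob_space_axioms m _ digits(1) D] by simp
    also have "\<dots> = (\<Sum>j=1..m. ennreal (p j * measure \<mu> (ifs_map \<theta> (a j) -` D)))"
    proof (rule sum.cong)
      fix j assume j: "j \<in> {1..m}"
      have "ifs_map \<theta> (a j) -` D \<in> sets borel"
        using D by (rule measurable_sets_borel[OF measurable_ifs_map])
      then have "emeasure \<mu> (ifs_map \<theta> (a j) -` D) = emeasure S {\<omega> \<in> space S. X (?c (j, \<omega>)) \<in> D}"
        unfolding \<mu>_def using j
        by (subst emeasure_distr) (auto simp: X_cons b_def intro!: arg_cong2[of _ _ _ _ emeasure])
      moreover have "emeasure \<mu> (ifs_map \<theta> (a j) -` D) = ennreal (measure \<mu> (ifs_map \<theta> (a j) -` D))"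
        unfolding \<mu>_def using P.prob_space_distr[OF X_meas]
        by (intro finite_measure.emeasure_eq_measure prob_space.finite_measure)
      ultimately show "ennreal (pmf P j) * emeasure S {\<omega> \<in> space S. X (?c (j, \<omega>)) \<in> D}
          = ennreal (p j * measure \<mu> (ifs_map \<theta> (a j) -` D))"
        using digits(2) p(1) j by (simp add: ennreal_mult less_imp_le)
    qed simp
    also have "\<dots> = ennreal (\<Sum>j=1..m. p j * measure \<mu> (ifs_map \<theta> (a j) -` D))"
      using p(1) by (intro sum_ennreal mult_nonneg_nonneg) (auto intro: less_imp_le)
    finally have "emeasure \<mu> D = ennreal (\<Sum>j=1..m. p j * measure \<mu> (ifs_map \<theta> (a j) -` D))" .
    moreover have "0 \<le> (\<Sum>j=1..m. p j * measure \<mu> (ifs_map \<theta> (a j) -` D))"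
      using p(1) by (intro sum_nonneg mult_nonneg_nonneg) (auto intro: less_imp_le)
    ultimately show ?thesis
      unfolding measure_def[of \<mu> D] by (simp only: enn2real_ennreal)
  qed
  then have "is_self_affine_measure \<theta> m a p \<mu>"
    unfolding is_self_affine_measure_def using P.prob_space_distr[OF X_meas] by (simp add: \<mu>_def)
  then show ?thesis ..
qed

text \<open>
  The indicator of a closed set is the limit of the Lipschitz functions \<open>max 0 (1 - n infdist x F)\<close>, and the closed
  sets generate the Borel sets.
\<close>
lemma borel_prob_eqI_lipschitz:
  fixes \<mu> \<nu> :: "'a::euclidean_space measure"
  assumes sets: "sets \<mu> = sets borel" "sets \<nu> = sets borel" and "prob_space \<mu>" "prob_space \<nu>"
    and eq: "\<And>(f :: 'a \<Rightarrow> real) L. (\<And>x. 0 \<le> f x \<and> f x \<le> 1) \<Longrightarrow> L \<ge> 0 \<Longrightarrow>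
      (\<And>x y. \<bar>f x - f y\<bar> \<le> L * dist x y) \<Longrightarrow> (\<integral>x. f x \<partial>\<mu>) = (\<integral>x. f x \<partial>\<nu>)"
  shows "\<mu> = \<nu>"
proof -
  interpret \<mu>: prob_space \<mu> by fact
  interpret \<nu>: prob_space \<nu> by fact
  have closed_eq: "measure \<mu> F = measure \<nu> F" if F: "closed F" "F \<noteq> {}" for F
  proof -
    define f where "f n x = max 0 (1 - real n * infdist x F)" for n x
    have f01: "0 \<le> f n x \<and> f n x \<le> 1" for n x
      by (auto simp: f_def infdist_nonneg)
    have lip: "\<bar>f n x - f n y\<bar> \<le> real n * dist x y" for n x y
    proof -
      have "\<bar>infdist x F - infdist y F\<bar> \<le> dist x y"
        using infdist_triangle[of x F y] infdist_triangle[of y F x] by (simp add: dist_commute abs_le_iff)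
      then have "real n * \<bar>infdist x F - infdist y F\<bar> \<le> real n * dist x y"
        by (intro mult_left_mono) auto
      moreover have "\<bar>f n x - f n y\<bar> \<le> \<bar>real n * infdist x F - real n * infdist y F\<bar>"
        unfolding f_def by linarith
      ultimately show ?thesis
        by (simp add: abs_mult right_diff_distrib[symmetric])
    qed
    have lim: "(\<lambda>n. f n x) \<longlonglongrightarrow> indicator F x" for x
    proof (cases "x \<in> F")
      case True
      then show ?thesis by (simp add: f_def)
    next
      case False
      then have pos: "infdist x F > 0"
        using F infdist_pos_not_in_closed by blast
      obtain N :: nat where N: "1 < real N * infdist x F"
        using reals_Archimedean3[OF pos] by blast
      have "f n x = 0" if "n \<ge> N" for n
      proof -
        have "real N * infdist x F \<le> real n * infdist x F"
          using that pos by (intro mult_right_mono) auto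
        then show ?thesis using N by (simp add: f_def)
      qed
      then have "eventually (\<lambda>n. f n x = indicator F x) sequentially"
        using False by (auto simp: eventually_sequentially)
      then show ?thesis by (rule tendsto_eventually)
    qed
    have f_meas: "f n \<in> borel_measurable borel" for n
      unfolding f_def by (intro borel_measurable_continuous_onI continuous_intros)
    have conv: "(\<lambda>n. \<integral>x. f n x \<partial>M) \<longlonglongrightarrow> measure M F"
      if M: "prob_space M" "sets M = sets borel" for M
    proof -
      interpret M: prob_space M by fact
      have "(\<lambda>n. \<integral>x. f n x \<partial>M) \<longlonglongrightarrow> (\<integral>x. indicator F x \<partial>M)"
      proof (rule integral_dominated_convergence[where w = "\<lambda>_. 1"])
        show "f n \<in> borel_measurable M" for n
          using f_meas M(2) by (simp cong: measurable_cong_sets)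
        show "(indicator F :: 'a \<Rightarrow> real) \<in> borel_measurable M"
          using F M(2) by (intro borel_measurable_indicator) auto
      qed (use lim f01 in auto)
      moreover have "space M = UNIV"
        using M(2) by (auto dest: sets_eq_imp_space_eq)
      ultimately show ?thesis by simp
    qed
    have "(\<lambda>n. \<integral>x. f n x \<partial>\<mu>) = (\<lambda>n. \<integral>x. f n x \<partial>\<nu>)"
      using eq[OF f01 _ lip] by auto
    then show ?thesis
      using conv[OF \<open>prob_space \<mu>\<close> sets(1)] conv[OF \<open>prob_space \<nu>\<close> sets(2)] LIMSEQ_unique by metis
  qed
  show ?thesis
  proof (rule measure_eqI_generator_eq[where E = "{F. closed F}" and \<Omega> = UNIV and A = "\<lambda>_. UNIV"])
    show "Int_stable {F :: 'a set. closed F}"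
      by (auto simp: Int_stable_def)
    show "emeasure \<mu> F = emeasure \<nu> F" if "F \<in> {F. closed F}" for F
      using that closed_eq[of F] by (cases "F = {}") (auto simp: \<mu>.emeasure_eq_measure \<nu>.emeasure_eq_measure)
    show "sets \<mu> = sigma_sets UNIV {F. closed F}" "sets \<nu> = sigma_sets UNIV {F. closed F}"
      by (simp_all add: sets borel_eq_closed)
  qed (auto simp: \<mu>.emeasure_eq_measure)
qed

text \<open>
  Let \<open>T\<close> be the operator \<open>g \<mapsto> \<Sum>\<^sub>j p\<^sub>j g (A x + a\<^sub>j)\<close>. Every self-affine measure gives \<open>f\<close> and \<open>T\<^sup>n f\<close> the same integral, and
  \<open>T\<^sup>n f\<close> flattens out because \<open>A\<close> is a contraction; so the integral of \<open>f\<close> is the limit of \<open>T\<^sup>n f\<close> at 0, which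
  does not depend on the measure.
\<close>
lemma self_affine_measure_unique:
  fixes \<theta> :: "real ^ 'n"
  assumes \<theta>: "\<forall>j. \<bar>\<theta> $ j\<bar> > 1"
    and p: "\<forall>j\<in>{1..m}. p j > 0" "(\<Sum>j=1..m. p j) = 1"
    and \<mu>: "is_self_affine_measure \<theta> m a p \<mu>" and \<nu>: "is_self_affine_measure \<theta> m a p \<nu>"
  shows "\<mu> = \<nu>"
proof (rule borel_prob_eqI_lipschitz)
  fix f :: "real ^ 'n \<Rightarrow> real" and L :: real
  assume f01: "\<And>x. 0 \<le> f x \<and> f x \<le> 1" and L: "L \<ge> 0"
    and lip: "\<And>x y. \<bar>f x - f y\<bar> \<le> L * dist x y"
  obtain r where r: "0 \<le> r" "r < 1" "\<And>x. norm (contraction_matrix \<theta> *v x) \<le> r * norm x"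
    using contraction_factor[OF \<theta>] by blast
  define T where "T g x = (\<Sum>j=1..m. p j * g (ifs_map \<theta> (a j) x))" for g :: "real ^ 'n \<Rightarrow> real" and x
  define h where "h n = (T ^^ n) f" for n
  have h01: "0 \<le> h n x \<and> h n x \<le> 1" for n x
  proof (induction n arbitrary: x)
    case 0
    then show ?case using f01 by (simp add: h_def)
  next
    case (Suc n)
    have "h (Suc n) x = (\<Sum>j=1..m. p j * h n (ifs_map \<theta> (a j) x))"
      by (simp add: h_def T_def)
    moreover have "\<dots> \<le> (\<Sum>j=1..m. p j * 1)"
      using Suc p by (intro sum_mono mult_left_mono) (auto intro: less_imp_le)
    moreover have "0 \<le> \<dots>"
      using Suc p by (simp add: sum_nonneg)
    moreover have "0 \<le> (\<Sum>j=1..m. p j * h n (ifs_map \<theta> (a j) x))"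
      using Suc p by (intro sum_nonneg mult_nonneg_nonneg) (auto intro: less_imp_le)
    ultimately show ?case using p by simp
  qed
  have hlip: "\<bar>h n x - h n y\<bar> \<le> L * r ^ n * dist x y" for n x y
  proof (induction n arbitrary: x y)
    case 0
    then show ?case using lip by (simp add: h_def)
  next
    case (Suc n)
    have "\<bar>h (Suc n) x - h (Suc n) y\<bar>
        = \<bar>\<Sum>j=1..m. p j * (h n (ifs_map \<theta> (a j) x) - h n (ifs_map \<theta> (a j) y))\<bar>"
      by (simp add: h_def T_def sum_subtractf right_diff_distrib)
    also have "\<dots> \<le> (\<Sum>j=1..m. \<bar>p j * (h n (ifs_map \<theta> (a j) x) - h n (ifs_map \<theta> (a j) y))\<bar>)"
      by (rule sum_abs)
    also have "\<dots> \<le> (\<Sum>j=1..m. p j * (L * r ^ Suc n * dist x y))"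
    proof (rule sum_mono)
      fix j assume j: "j \<in> {1..m}"
      have "dist (ifs_map \<theta> (a j) x) (ifs_map \<theta> (a j) y) \<le> r * dist x y"
        using r(3)[of "x - y"] by (simp add: ifs_map_def dist_norm matrix_vector_mult_diff_distrib)
      then have "L * r ^ n * dist (ifs_map \<theta> (a j) x) (ifs_map \<theta> (a j) y) \<le> L * r ^ n * (r * dist x y)"
        using L r by (intro mult_left_mono) auto
      then have "\<bar>h n (ifs_map \<theta> (a j) x) - h n (ifs_map \<theta> (a j) y)\<bar> \<le> L * r ^ Suc n * dist x y"
        using Suc[of "ifs_map \<theta> (a j) x" "ifs_map \<theta> (a j) y"] by (simp add: mult_ac)
      then show "\<bar>p j * (h n (ifs_map \<theta> (a j) x) - h n (ifs_map \<theta> (a j) y))\<bar> \<le> p j * (L * r ^ Suc n * dist x y)"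
        using p(1) j by (simp add: abs_mult less_imp_le mult_left_mono)
    qed
    also have "\<dots> = L * r ^ Suc n * dist x y"
      using p(2) by (simp add: sum_distrib_right[symmetric])
    finally show ?case .
  qed
  have h_meas: "h n \<in> borel_measurable borel" for n
  proof (rule borel_measurable_continuous_onI)
    have "(L * r ^ n)-lipschitz_on UNIV (h n)"
      using hlip L r by (intro lipschitz_onI) (auto simp: dist_real_def)
    then show "continuous_on UNIV (h n)"
      by (rule lipschitz_on_continuous_on)
  qed
  have conv: "(\<lambda>n. h n 0) \<longlonglongrightarrow> (\<integral>x. f x \<partial>M)" if M: "is_self_affine_measure \<theta> m a p M" for M
  proof -
    interpret M: prob_space M
      using M by (simp add: is_self_affine_measure_def)
    have sets: "sets M = sets borel"
      using M by (simp add: is_self_affine_measure_def)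
    have h_measM: "h n \<in> borel_measurable M" for n
      using h_meas sets by (simp cong: measurable_cong_sets)
    have h_int: "integrable M (h n)" for n
      using h_measM h01 by (intro M.integrable_const_bound[where B = 1]) auto
    have same: "(\<integral>x. h n x \<partial>M) = (\<integral>x. f x \<partial>M)" for n
    proof (induction n)
      case (Suc n)
      have "(\<integral>x. h n x \<partial>M) = (\<Sum>j=1..m. p j *\<^sub>R (\<integral>x. h n (ifs_map \<theta> (a j) x) \<partial>M))"
        using h01 by (intro integral_self_affine[OF M p h_meas, where c = 1]) auto
      also have "\<dots> = (\<integral>x. (\<Sum>j=1..m. p j * h n (ifs_map \<theta> (a j) x)) \<partial>M)"
      proof (subst Bochner_Integration.integral_sum)
        fix j
        have "(\<lambda>x. h n (ifs_map \<theta> (a j) x)) \<in> borel_measurable M"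
          using measurable_compose[OF measurable_ifs_map h_meas] sets by (simp cong: measurable_cong_sets)
        then have "integrable M (\<lambda>x. h n (ifs_map \<theta> (a j) x))"
          using h01 by (intro M.integrable_const_bound[where B = 1]) auto
        then show "integrable M (\<lambda>x. p j * h n (ifs_map \<theta> (a j) x))" by simp
      qed simp
      finally show ?case using Suc by (simp add: h_def T_def[abs_def])
    qed (simp add: h_def)
    have "(\<lambda>n. \<integral>x. (h n x - h n 0) \<partial>M) \<longlonglongrightarrow> (\<integral>x. 0 \<partial>M)"
    proof (rule integral_dominated_convergence[where w = "\<lambda>_. 1"])
      show "AE x in M. (\<lambda>n. h n x - h n 0) \<longlonglongrightarrow> 0"
      proof (intro AE_I2)
        fix x :: "real ^ 'n"
        have "(\<lambda>n. L * r ^ n * dist x 0) \<longlonglongrightarrow> L * 0 * dist x 0"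
          using r by (intro tendsto_intros LIMSEQ_realpow_zero) auto
        then have "(\<lambda>n. L * r ^ n * dist x 0) \<longlonglongrightarrow> 0" by simp
        moreover have "eventually (\<lambda>n. norm (h n x - h n 0) \<le> L * r ^ n * dist x 0) sequentially"
          unfolding real_norm_def by (intro always_eventually allI hlip)
        ultimately show "(\<lambda>n. h n x - h n 0) \<longlonglongrightarrow> 0"
          by (rule Lim_null_comparison[rotated])
      qed
      show "AE x in M. norm (h n x - h n 0) \<le> 1" for n
      proof (intro AE_I2)
        fix x :: "real ^ 'n"
        show "norm (h n x - h n 0) \<le> 1"
          using h01[of n x] h01[of n 0] by (simp add: abs_le_iff)
      qed
    qed (use h_measM in auto)
    then have "(\<lambda>n. (\<integral>x. f x \<partial>M) - h n 0) \<longlonglongrightarrow> 0"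
      using h_int by (simp add: same M.prob_space)
    then show ?thesis
      using tendsto_diff[OF tendsto_const[of "\<integral>x. f x \<partial>M"]] by fastforce
  qed
  show "(\<integral>x. f x \<partial>\<mu>) = (\<integral>x. f x \<partial>\<nu>)"
    using conv[OF \<mu>] conv[OF \<nu>] by (rule LIMSEQ_unique)
qed (use \<mu> \<nu> in \<open>auto simp: is_self_affine_measure_def\<close>)

lemma is_self_affine_measure_self_affine_measure:
  fixes \<theta> :: "real ^ 'n"
  assumes "\<forall>j. \<bar>\<theta> $ j\<bar> > 1" "\<forall>j\<in>{1..m}. p j > 0" "(\<Sum>j=1..m. p j) = 1"
  shows "is_self_affine_measure \<theta> m a p (self_affine_measure \<theta> m a p)"
proof -
  obtain \<mu> where \<mu>: "is_self_affine_measure \<theta> m a p \<mu>"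
    using exists_self_affine_measure[OF assms, of a] ..
  have "\<exists>!\<mu>. is_self_affine_measure \<theta> m a p \<mu>"
    using \<mu> self_affine_measure_unique[OF assms _ \<mu>] by blast
  then show ?thesis
    unfolding self_affine_measure_def by (rule theI')
qed

section \<open>The Fourier transform of a self-affine measure\<close>

text \<open>
  The Fourier transform of the law of a random digit.
\<close>
definition mask_polynomial :: "nat \<Rightarrow> (nat \<Rightarrow> real ^ 'n) \<Rightarrow> (nat \<Rightarrow> real) \<Rightarrow> real ^ 'n \<Rightarrow> complex" where
  "mask_polynomial m a p \<xi> = (\<Sum>j=1..m. p j *\<^sub>R cis (- (2 * pi * (\<xi> \<bullet> a j))))"

lemma fourier_eq_integral_cis: "fourier \<mu> \<xi> = (\<integral>x. cis (- (2 * pi * (\<xi> \<bullet> x))) \<partial>\<mu>)"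
  unfolding fourier_def cis_conv_exp by (intro Bochner_Integration.integral_cong) (auto simp: mult_ac)

lemma fourier_self_affine:
  fixes \<theta> :: "real ^ 'n"
  assumes \<mu>: "is_self_affine_measure \<theta> m a p \<mu>"
    and p: "\<forall>j\<in>{1..m}. p j > 0" "(\<Sum>j=1..m. p j) = 1"
  shows "fourier \<mu> \<xi> = mask_polynomial m a p \<xi> * fourier \<mu> (contraction_matrix \<theta> *v \<xi>)"
proof -
  have m: "(\<lambda>x. cis (- (2 * pi * (\<xi> \<bullet> x)))) \<in> borel_measurable borel"
    by (intro borel_measurable_continuous_onI continuous_intros)
  have "fourier \<mu> \<xi> = (\<Sum>j=1..m. p j *\<^sub>R (\<integral>x. cis (- (2 * pi * (\<xi> \<bullet> ifs_map \<theta> (a j) x))) \<partial>\<mu>))"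
    unfolding fourier_eq_integral_cis by (rule integral_self_affine[OF \<mu> p m, where c = 1]) simp
  also have "\<dots> = (\<Sum>j=1..m. p j *\<^sub>R (cis (- (2 * pi * (\<xi> \<bullet> a j))) * fourier \<mu> (contraction_matrix \<theta> *v \<xi>)))"
  proof (intro sum.cong refl arg_cong2[of _ _ _ _ scaleR])
    fix j
    have "cis (- (2 * pi * (\<xi> \<bullet> ifs_map \<theta> (a j) x))) = cis (- (2 * pi * (\<xi> \<bullet> a j)))
        * cis (- (2 * pi * ((contraction_matrix \<theta> *v \<xi>) \<bullet> x)))" for x
      by (simp add: ifs_map_def inner_add_right inner_contraction_commute cis_mult algebra_simps)
    then show "(\<integral>x. cis (- (2 * pi * (\<xi> \<bullet> ifs_map \<theta> (a j) x))) \<partial>\<mu>)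
        = cis (- (2 * pi * (\<xi> \<bullet> a j))) * fourier \<mu> (contraction_matrix \<theta> *v \<xi>)"
      by (simp add: fourier_eq_integral_cis)
  qed
  finally show ?thesis
    by (simp add: mask_polynomial_def sum_distrib_right)
qed

lemma norm_mask_polynomial_le_1:
  assumes "\<forall>j\<in>{1..m}. p j > 0" "(\<Sum>j=1..m. p j) = 1"
  shows "norm (mask_polynomial m a p \<xi>) \<le> 1"
proof -
  have "norm (mask_polynomial m a p \<xi>) \<le> (\<Sum>j=1..m. norm (p j *\<^sub>R cis (- (2 * pi * (\<xi> \<bullet> a j)))))"
    unfolding mask_polynomial_def by (rule norm_sum)
  also have "\<dots> = (\<Sum>j=1..m. p j)"
    using assms(1) by (intro sum.cong) (auto simp: abs_of_pos)
  finally show ?thesis using assms(2) by simp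
qed

lemma norm_fourier_le_prod_mask_polynomial:
  fixes \<theta> :: "real ^ 'n"
  assumes \<mu>: "is_self_affine_measure \<theta> m a p \<mu>"
    and p: "\<forall>j\<in>{1..m}. p j > 0" "(\<Sum>j=1..m. p j) = 1"
  shows "norm (fourier \<mu> \<xi>) \<le> (\<Prod>n<N. norm (mask_polynomial m a p (((\<lambda>x. contraction_matrix \<theta> *v x) ^^ n) \<xi>)))"
proof -
  interpret prob_space \<mu>
    using \<mu> by (simp add: is_self_affine_measure_def)
  have le1: "norm (fourier \<mu> \<xi>) \<le> 1" for \<xi>
  proof -
    have "norm (fourier \<mu> \<xi>) \<le> (\<integral>x. norm (cis (- (2 * pi * (\<xi> \<bullet> x)))) \<partial>\<mu>)"
      unfolding fourier_eq_integral_cis by (rule integral_norm_bound)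
    then show ?thesis by (simp add: prob_space)
  qed
  have "norm (fourier \<mu> \<xi>) = (\<Prod>n<N. norm (mask_polynomial m a p (((\<lambda>x. contraction_matrix \<theta> *v x) ^^ n) \<xi>)))
      * norm (fourier \<mu> (((\<lambda>x. contraction_matrix \<theta> *v x) ^^ N) \<xi>))"
  proof (induction N)
    case (Suc N)
    then show ?case
      using fourier_self_affine[OF \<mu> p, of "((\<lambda>x. contraction_matrix \<theta> *v x) ^^ N) \<xi>"]
      by (simp add: norm_mult)
  qed simp
  then show ?thesis
    using le1 by (simp add: mult_left_le prod_nonneg)
qed

text \<open>
  With \<open>w = p q (1 - cos (u - v))\<close> the square of the norm is \<open>(p + q)\<^sup>2 - 2 w\<close>, and \<open>p + q \<le> 1\<close> turns this into
  the bound \<open>(p + q - w)\<^sup>2\<close>.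
\<close>
lemma norm_two_cis_le:
  fixes p q :: real
  assumes "p > 0" "q > 0" "p + q \<le> 1"
  shows "norm (p *\<^sub>R cis u + q *\<^sub>R cis v) \<le> p + q - p * q * (1 - cos (u - v))"
proof (rule power2_le_imp_le)
  define w where "w = p * q * (1 - cos (u - v))"
  have "(norm (p *\<^sub>R cis u + q *\<^sub>R cis v))\<^sup>2 = (p * cos u + q * cos v)\<^sup>2 + (p * sin u + q * sin v)\<^sup>2"
    by (simp add: cmod_power2)
  also have "\<dots> = p\<^sup>2 * ((sin u)\<^sup>2 + (cos u)\<^sup>2) + q\<^sup>2 * ((sin v)\<^sup>2 + (cos v)\<^sup>2) + 2 * (p * q) * cos (u - v)"
    unfolding cos_diff by algebra
  also have "\<dots> = (p + q)\<^sup>2 - 2 * w"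
    unfolding sin_cos_squared_add w_def by (simp add: power2_eq_square algebra_simps)
  also have "\<dots> \<le> (p + q - w)\<^sup>2"
  proof -
    have "w \<ge> 0"
      unfolding w_def using assms by simp
    then have "(p + q) * w \<le> 1 * w"
      using assms by (intro mult_right_mono) auto
    moreover have "(p + q - w)\<^sup>2 = (p + q)\<^sup>2 - 2 * ((p + q) * w) + w\<^sup>2"
      by (simp add: power2_eq_square algebra_simps)
    ultimately show ?thesis
      using zero_le_power2[of w] by linarith
  qed
  finally show "(norm (p *\<^sub>R cis u + q *\<^sub>R cis v))\<^sup>2 \<le> (p + q - p * q * (1 - cos (u - v)))\<^sup>2"
    by (simp add: w_def)
  have "1 - cos (u - v) \<le> 2"
    using cos_ge_minus_one[of "u - v"] by simp
  then have "p * q * (1 - cos (u - v)) \<le> p * q * 2"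
    using assms by (intro mult_left_mono) auto
  also have "p * q * 2 \<le> p + q"
  proof -
    have "p * q \<le> p * 1" "p * q \<le> 1 * q"
      using assms by (intro mult_mono; simp)+
    then show ?thesis by simp
  qed
  finally show "0 \<le> p + q - p * q * (1 - cos (u - v))" by simp
qed

text \<open>
  Two digits out of phase already cause a loss: the triangle inequality is applied to all the other terms.
\<close>
lemma norm_mask_polynomial_le:
  assumes p: "\<forall>j\<in>{1..m}. p j > 0" "(\<Sum>j=1..m. p j) = 1"
    and ij: "i \<in> {1..m}" "j \<in> {1..m}" "i \<noteq> j"
  shows "norm (mask_polynomial m a p \<xi>) \<le> 1 - p i * p j * (1 - cos (2 * pi * (\<xi> \<bullet> (a j - a i))))"
proof -
  let ?e = "\<lambda>k. p k *\<^sub>R cis (- (2 * pi * (\<xi> \<bullet> a k)))"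
  let ?R = "{1..m} - {i} - {j}"
  have split: "(\<Sum>k=1..m. g k) = g i + (g j + (\<Sum>k\<in>?R. g k))" for g :: "nat \<Rightarrow> 'b::comm_monoid_add"
  proof -
    have "(\<Sum>k=1..m. g k) = g i + (\<Sum>k\<in>{1..m} - {i}. g k)"
      using ij by (intro sum.remove) auto
    also have "(\<Sum>k\<in>{1..m} - {i}. g k) = g j + (\<Sum>k\<in>?R. g k)"
      using ij by (intro sum.remove) auto
    finally show ?thesis .
  qed
  have rest: "(\<Sum>k\<in>?R. p k) = 1 - (p i + p j)"
    using split[of p] p(2) by simp
  moreover have "0 \<le> (\<Sum>k\<in>?R. p k)"
    using p(1) by (intro sum_nonneg) (auto intro: less_imp_le)
  ultimately have pij: "p i + p j \<le> 1" by simp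
  have "norm (mask_polynomial m a p \<xi>) = norm ((?e i + ?e j) + (\<Sum>k\<in>?R. ?e k))"
    unfolding mask_polynomial_def split[of ?e] by (simp add: add.assoc)
  also have "\<dots> \<le> norm (?e i + ?e j) + (\<Sum>k\<in>?R. norm (?e k))"
    by (rule order.trans[OF norm_triangle_ineq add_left_mono[OF norm_sum]])
  also have "(\<Sum>k\<in>?R. norm (?e k)) = 1 - (p i + p j)"
    using p(1) by (subst rest[symmetric], intro sum.cong) (auto simp: abs_of_pos)
  also have "norm (?e i + ?e j) \<le> p i + p j
      - p i * p j * (1 - cos (- (2 * pi * (\<xi> \<bullet> a i)) - - (2 * pi * (\<xi> \<bullet> a j))))"
    using p(1) ij pij by (intro norm_two_cis_le) auto
  also have "- (2 * pi * (\<xi> \<bullet> a i)) - - (2 * pi * (\<xi> \<bullet> a j)) = 2 * pi * (\<xi> \<bullet> (a j - a i))"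
    by (simp add: inner_diff_right algebra_simps)
  finally show ?thesis by simp
qed

section \<open>Power decay for almost every parameter\<close>

text \<open>
  If all digits had the same \<open>k\<close>-th coordinate, then so would all points of the attractor, which would
  lie in a hyperplane.
\<close>
lemma irreducible_digits_differ:
  fixes \<theta> :: "real ^ 'n" and m :: nat
  assumes \<theta>: "\<forall>j. \<bar>\<theta> $ j\<bar> > 1" and irr: "affinely_irreducible \<theta> (a ` {1..m})"
  shows "\<exists>j\<in>{1..m}. a j $ k \<noteq> a 1 $ k"
proof (rule ccontr)
  assume "\<not> ?thesis"
  then have same: "a j $ k = a 1 $ k" if "j \<in> {1..m}" for j
    using that by blast
  let ?A = "\<lambda>x. contraction_matrix \<theta> *v x"
  define c where "c = (\<Sum>n. a 1 $ k / \<theta> $ k ^ n)"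
  define H where "H = {x :: real ^ 'n. axis k 1 \<bullet> x = c}"
  have "attractor \<theta> (a ` {1..m}) \<subseteq> H"
  proof
    fix x assume "x \<in> attractor \<theta> (a ` {1..m})"
    then obtain b where b: "x = (\<Sum>n. (?A ^^ n) (b n))" "\<And>n. b n \<in> a ` {1..m}"
      unfolding attractor_def by blast
    have "norm (b n) \<le> (\<Sum>j=1..m. norm (a j))" for n
    proof -
      obtain j where "j \<in> {1..m}" "b n = a j"
        using b(2)[of n] by blast
      then show ?thesis
        using member_le_sum[of j "{1..m}" "\<lambda>j. norm (a j)"] by simp
    qed
    then have "summable (\<lambda>n. (?A ^^ n) (b n))"
      by (rule summable_contraction_series[OF \<theta>])
    then have "x $ k = (\<Sum>n. (?A ^^ n) (b n) $ k)"
      unfolding b(1) by (rule bounded_linear.suminf[OF bounded_linear_vec_nth])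
    also have "\<dots> = c"
      unfolding c_def contraction_power_component
    proof (intro suminf_cong arg_cong2[of _ _ _ _ "(/)"] refl)
      fix n
      obtain j where "j \<in> {1..m}" "b n = a j"
        using b(2)[of n] by blast
      then show "b n $ k = a 1 $ k"
        using same by (simp only:)
    qed
    finally show "x \<in> H"
      by (simp add: H_def inner_axis')
  qed
  moreover have "affine H"
    unfolding H_def by (rule affine_hyperplane)
  moreover have "(\<chi> i. c + 1) \<notin> H"
    by (simp add: H_def inner_axis')
  ultimately show False
    using irr unfolding affinely_irreducible_def by blast
qed

text \<open>
  The first time \<open>N\<close> at which \<open>A\<^sup>N \<xi>\<close> lies in the unit cube: some coordinate has only just entered it.
\<close>
lemma exists_comparable_scale:
  fixes \<theta> \<xi> :: "real ^ 'n"
  assumes "\<forall>j. \<bar>\<theta> $ j\<bar> > 1"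
  obtains N where "\<And>i. \<bar>\<xi> $ i\<bar> \<le> \<bar>\<theta> $ i\<bar> ^ N"
    and "N = 0 \<or> (\<exists>k. \<bar>\<theta> $ k\<bar> ^ (N - 1) < \<bar>\<xi> $ k\<bar>)"
proof -
  have "eventually (\<lambda>N. \<bar>\<xi> $ i\<bar> \<le> \<bar>\<theta> $ i\<bar> ^ N) sequentially" for i
  proof -
    obtain n where n: "\<bar>\<xi> $ i\<bar> < \<bar>\<theta> $ i\<bar> ^ n"
      using real_arch_pow assms by blast
    have "\<bar>\<xi> $ i\<bar> \<le> \<bar>\<theta> $ i\<bar> ^ N" if "N \<ge> n" for N
    proof -
      have "\<bar>\<theta> $ i\<bar> ^ n \<le> \<bar>\<theta> $ i\<bar> ^ N"
        using assms that by (intro power_increasing) (auto intro: less_imp_le)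
      then show ?thesis using n by linarith
    qed
    then show ?thesis by (auto simp: eventually_sequentially)
  qed
  then have "eventually (\<lambda>N. \<forall>i. \<bar>\<xi> $ i\<bar> \<le> \<bar>\<theta> $ i\<bar> ^ N) sequentially"
    by (rule eventually_all_finite)
  then have ex: "\<exists>N. \<forall>i. \<bar>\<xi> $ i\<bar> \<le> \<bar>\<theta> $ i\<bar> ^ N"
    by (auto simp: eventually_sequentially)
  define N where "N = (LEAST N. \<forall>i. \<bar>\<xi> $ i\<bar> \<le> \<bar>\<theta> $ i\<bar> ^ N)"
  have N: "\<forall>i. \<bar>\<xi> $ i\<bar> \<le> \<bar>\<theta> $ i\<bar> ^ N"
    unfolding N_def using ex by (rule LeastI_ex)
  have minimal: "\<exists>k. \<bar>\<theta> $ k\<bar> ^ (N - 1) < \<bar>\<xi> $ k\<bar>" if "N \<noteq> 0"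
  proof -
    have "N - 1 < N" using that by simp
    then have "\<not> (\<forall>i. \<bar>\<xi> $ i\<bar> \<le> \<bar>\<theta> $ i\<bar> ^ (N - 1))"
      unfolding N_def by (rule not_less_Least)
    then show ?thesis by (auto simp: not_le)
  qed
  show thesis
    by (rule that[of N]) (use N minimal in auto)
qed

text \<open>
  Reversing time from \<open>N\<close> turns the contracting phases \<open>\<langle>A\<^sup>l \<xi>, b\<rangle>\<close> into an expanding exponential sum.
\<close>
lemma orbit_eq_inner:
  fixes \<theta> \<xi> b :: "real ^ 'n"
  assumes \<theta>: "\<forall>j. \<bar>\<theta> $ j\<bar> > 1" and "n \<le> N"
  shows "orbit \<theta> (\<chi> i. \<xi> $ i * b $ i / \<theta> $ i ^ N) n
    = ((\<lambda>x. contraction_matrix \<theta> *v x) ^^ (N - n)) \<xi> \<bullet> b"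
  unfolding orbit_def inner_vec_def
proof (rule sum.cong)
  fix i
  have "\<theta> $ i \<noteq> 0" using \<theta>[rule_format, of i] by auto
  then have "\<theta> $ i ^ N = \<theta> $ i ^ (N - n) * \<theta> $ i ^ n"
    using assms(2) by (simp add: power_add[symmetric])
  then show "(\<chi> i. \<xi> $ i * b $ i / \<theta> $ i ^ N) $ i * \<theta> $ i ^ n
      = ((\<lambda>x. contraction_matrix \<theta> *v x) ^^ (N - n)) \<xi> $ i \<bullet> b $ i"
    using \<open>\<theta> $ i \<noteq> 0\<close> by (simp add: contraction_power_component)
qed simp

text \<open>
  Given \<open>\<xi>\<close>, take the coordinate \<open>k\<close> that is the last to become at most 1 and the digit \<open>d k\<close>. Since \<open>\<theta>\<close> is not resonant at the
  corresponding scale \<open>N\<close>, more than \<open>\<delta> N\<close> factors of the product are at most \<open>\<tau>\<close>. The exponent \<open>\<alpha>\<close> is chosen such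
  that \<open>\<tau>\<^sup>\<delta> = J\<^sup>-\<^sup>\<alpha>\<close>, and \<open>J\<^sup>N\<close> is at least a constant times the norm of \<open>\<xi>\<close>.
\<close>
lemma fourier_decay_if_nonresonant:
  fixes \<theta> :: "real ^ 'n"
  assumes \<mu>: "is_self_affine_measure \<theta> m a p \<mu>"
    and \<theta>: "\<forall>j. \<bar>\<theta> $ j\<bar> > 1"
    and p: "\<forall>j\<in>{1..m}. p j > 0" "(\<Sum>j=1..m. p j) = 1"
    and J: "J > 1" "\<And>i. 1 + 1 / J \<le> \<bar>\<theta> $ i\<bar>" "\<And>i. \<bar>\<theta> $ i\<bar> \<le> J"
      "\<And>i k. i \<noteq> k \<Longrightarrow> 1 / J \<le> \<bar>\<theta> $ k - \<theta> $ i\<bar>"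
    and d: "\<And>k. d k \<in> {2..m}" "\<And>k i. \<bar>(a (d k) - a 1) $ i\<bar> \<le> J"
      "\<And>k. 1 / J \<le> \<bar>(a (d k) - a 1) $ k\<bar> / \<bar>\<theta> $ k\<bar>"
    and \<rho>: "0 < \<rho>" "\<rho> < 1/2" "0 < \<delta>"
    and nonres: "\<And>k N. N \<ge> N0 \<Longrightarrow> \<theta> \<notin> resonant k J \<rho> \<delta> N"
  shows "\<mu> \<in> power_fourier_decay"
proof -
  let ?A = "\<lambda>x. contraction_matrix \<theta> *v x"
  define w where "w = Min (range (\<lambda>k. p 1 * p (d k) * (1 - cos (2 * pi * \<rho>))))"
  \<comment> \<open>The maximum keeps \<open>\<tau>\<close> positive, so that its logarithm and real powers make sense.\<close>
  define \<tau> where "\<tau> = max (1 - w) (1/2)"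
  define \<alpha> where "\<alpha> = \<delta> * (- ln \<tau>) / ln J"
  have one: "1 \<in> {1..m}" and d1: "d k \<in> {1..m}" "d k \<noteq> 1" for k
    using d(1)[of k] by auto
  have "cos (2 * pi * \<rho>) < cos 0"
    using \<rho> by (intro cos_monotone_0_pi) auto
  then have "p 1 * p (d k) * (1 - cos (2 * pi * \<rho>)) > 0" for k
    using p(1) one d1 by simp
  then have "w > 0"
    unfolding w_def by (subst Min_gr_iff) auto
  then have \<tau>: "0 < \<tau>" "\<tau> < 1"
    by (auto simp: \<tau>_def)
  have \<alpha>: "\<alpha> > 0"
    unfolding \<alpha>_def using \<tau> J(1) \<rho> by (intro divide_pos_pos mult_pos_pos) auto
  have mask_small: "norm (mask_polynomial m a p \<zeta>) \<le> \<tau>"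
    if "cos (2 * pi * (\<zeta> \<bullet> (a (d k) - a 1))) < cos (2 * pi * \<rho>)" for \<zeta> k
  proof -
    have "w \<le> p 1 * p (d k) * (1 - cos (2 * pi * \<rho>))"
      unfolding w_def by (intro Min_le) auto
    also have "\<dots> \<le> p 1 * p (d k) * (1 - cos (2 * pi * (\<zeta> \<bullet> (a (d k) - a 1))))"
      using that p(1) one d1 by (intro mult_left_mono) (auto intro!: mult_nonneg_nonneg less_imp_le)
    finally show ?thesis
      using norm_mask_polynomial_le[OF p one d1(1)[of k] d1(2)[of k, symmetric], of a \<zeta>] unfolding \<tau>_def by linarith
  qed
  have bound: "norm (fourier \<mu> \<xi>) \<le> real CARD('n) powr \<alpha> * norm \<xi> powr (- \<alpha>)"
    if large: "real CARD('n) * J ^ N0 < norm \<xi>" for \<xi>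
  proof -
    obtain N where N: "\<And>i. \<bar>\<xi> $ i\<bar> \<le> \<bar>\<theta> $ i\<bar> ^ N"
      "N = 0 \<or> (\<exists>k. \<bar>\<theta> $ k\<bar> ^ (N - 1) < \<bar>\<xi> $ k\<bar>)"
      using exists_comparable_scale[OF \<theta>, of \<xi>] by blast
    have "norm \<xi> \<le> (\<Sum>i\<in>UNIV. \<bar>\<xi> $ i\<bar>)"
      by (rule norm_le_l1_cart)
    also have "\<dots> \<le> (\<Sum>i\<in>(UNIV :: 'n set). J ^ N)"
    proof (rule sum_mono)
      fix i
      have "\<bar>\<theta> $ i\<bar> ^ N \<le> J ^ N"
        using J(3) by (intro power_mono) auto
      then show "\<bar>\<xi> $ i\<bar> \<le> J ^ N" using N(1)[of i] by linarith
    qed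
    finally have norm_le: "norm \<xi> \<le> real CARD('n) * J ^ N" by simp
    then have "real CARD('n) * J ^ N0 < real CARD('n) * J ^ N"
      using large by linarith
    then have "J ^ N0 < J ^ N"
      by simp
    then have "N0 < N"
      by (rule power_less_imp_less_exp[OF J(1)])
    then obtain k where k: "\<bar>\<theta> $ k\<bar> ^ (N - 1) < \<bar>\<xi> $ k\<bar>"
      using N(2) by auto
    define b where "b = a (d k) - a 1"
    define \<eta> where "\<eta> = (\<chi> i. \<xi> $ i * b $ i / \<theta> $ i ^ N)"
    define S where "S = {n \<in> {..<N}. cos (2 * pi * orbit \<theta> \<eta> n) < cos (2 * pi * \<rho>)}"
    have \<theta>pos: "\<bar>\<theta> $ i\<bar> > 0" for i
      using \<theta>[rule_format, of i] by linarith
    have \<eta>_le: "\<bar>\<eta> $ i\<bar> \<le> J" for i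
    proof -
      have "\<bar>\<xi> $ i\<bar> / \<bar>\<theta> $ i\<bar> ^ N * \<bar>b $ i\<bar> \<le> 1 * J"
        using N(1)[of i] d(2) J(1) \<theta>pos[of i] unfolding b_def
        by (intro mult_mono) (auto simp: divide_le_eq)
      then show ?thesis
        by (simp add: \<eta>_def abs_mult power_abs)
    qed
    have \<eta>_ge: "1 / J \<le> \<bar>\<eta> $ k\<bar>"
    proof -
      have "\<bar>\<theta> $ k\<bar> ^ N = \<bar>\<theta> $ k\<bar> * \<bar>\<theta> $ k\<bar> ^ (N - 1)"
        using \<open>N0 < N\<close> by (simp add: power_eq_if)
      then have "1 / \<bar>\<theta> $ k\<bar> \<le> \<bar>\<xi> $ k\<bar> / \<bar>\<theta> $ k\<bar> ^ N"
        using k \<theta>pos[of k] by (simp add: field_simps)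
      then have "\<bar>b $ k\<bar> * (1 / \<bar>\<theta> $ k\<bar>) \<le> \<bar>b $ k\<bar> * (\<bar>\<xi> $ k\<bar> / \<bar>\<theta> $ k\<bar> ^ N)"
        by (intro mult_left_mono) auto
      then show ?thesis
        using d(3)[of k] by (simp add: \<eta>_def b_def abs_mult power_abs mult.commute)
    qed
    have card_S: "\<delta> * real N < real (card S)"
    proof (rule ccontr)
      assume "\<not> ?thesis"
      then have "\<theta> \<in> resonant k J \<rho> \<delta> N"
        unfolding resonant_def using J \<eta>_le \<eta>_ge
        by (auto intro!: exI[of _ \<eta>] exI[of _ S] simp: S_def not_less)
      then show False
        using nonres \<open>N0 < N\<close> by simp
    qed
    \<comment> \<open>Time is reversed: \<open>S\<close> refers to the exponential sum, \<open>S'\<close> to the powers of \<open>A\<close>.\<close>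
    define S' where "S' = (\<lambda>n. N - n) ` S"
    have card_S': "card S' = card S"
      unfolding S'_def by (intro card_image inj_onI) (auto simp: S_def)
    have "norm (fourier \<mu> \<xi>) \<le> (\<Prod>n<Suc N. norm (mask_polynomial m a p ((?A ^^ n) \<xi>)))"
      by (rule norm_fourier_le_prod_mask_polynomial[OF \<mu> p])
    also have "\<dots> \<le> (\<Prod>n<Suc N. if n \<in> S' then \<tau> else 1)"
    proof (intro prod_mono conjI norm_ge_zero)
      fix l
      show "norm (mask_polynomial m a p ((?A ^^ l) \<xi>)) \<le> (if l \<in> S' then \<tau> else 1)"
      proof (cases "l \<in> S'")
        case True
        then obtain n where n: "n \<in> S" "l = N - n" by (auto simp: S'_def)
        then have "cos (2 * pi * ((?A ^^ l) \<xi> \<bullet> b)) < cos (2 * pi * \<rho>)"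
          using orbit_eq_inner[OF \<theta>, of n N \<xi> b] by (simp add: S_def \<eta>_def)
        then show ?thesis
          using mask_small True by (simp add: b_def)
      qed (use norm_mask_polynomial_le_1[OF p] in simp)
    qed
    also have "\<dots> = \<tau> ^ card S"
    proof -
      have "{..<Suc N} \<inter> S' = S'" by (auto simp: S'_def)
      then show ?thesis
        using card_S' prod.inter_restrict[of "{..<Suc N}" "\<lambda>_. \<tau>" S'] by (simp only: prod_constant finite_lessThan)
    qed
    also have "\<dots> = \<tau> powr real (card S)"
      using \<tau> by (simp add: powr_realpow)
    also have "\<dots> \<le> \<tau> powr (\<delta> * real N)"
      using \<tau> card_S by (intro powr_mono') auto
    also have "\<dots> = (J ^ N) powr (- \<alpha>)"
      using J(1) \<tau> by (simp add: powr_def ln_realpow \<alpha>_def)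
    also have "\<dots> \<le> (norm \<xi> / real CARD('n)) powr (- \<alpha>)"
    proof (rule powr_mono2')
      have "0 \<le> real CARD('n) * J ^ N0" using J(1) by simp
      then show "0 < norm \<xi> / real CARD('n)"
        using large by (intro divide_pos_pos) auto
      show "norm \<xi> / real CARD('n) \<le> J ^ N"
        using norm_le by (simp add: divide_le_eq mult.commute)
    qed (use \<alpha> in simp)
    also have "\<dots> = real CARD('n) powr \<alpha> * norm \<xi> powr (- \<alpha>)"
    proof -
      have "norm \<xi> > 0"
        using large J(1) by (smt (verit) mult_nonneg_nonneg of_nat_0_le_iff zero_le_power)
      then show ?thesis
        by (simp add: powr_divide powr_minus field_simps)
    qed
    finally show ?thesis .
  qed
  have "(\<lambda>t. norm (fourier \<mu> t)) \<in> O[at_infinity](\<lambda>t. norm t powr (- \<alpha>))"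
  proof (rule bigoI)
    show "eventually (\<lambda>t. norm (norm (fourier \<mu> t))
        \<le> real CARD('n) powr \<alpha> * norm (norm t powr (- \<alpha>))) at_infinity"
      unfolding eventually_at_infinity
      by (rule exI[of _ "real CARD('n) * J ^ N0 + 1"]) (auto intro: bound)
  qed
  moreover have "sets \<mu> = sets borel" "finite_measure \<mu>"
    using \<mu> by (auto simp: is_self_affine_measure_def prob_space.finite_measure)
  ultimately show ?thesis
    unfolding power_fourier_decay_def fourier_decay_of_order_def using \<alpha> by auto
qed

lemma null_set_coordinates_coincide:
  fixes i j :: "'n::finite"
  assumes "i \<noteq> j"
  shows "{\<theta> :: real ^ 'n. \<theta> $ i = \<theta> $ j} \<in> null_sets lebesgue"
proof -
  have "(axis i 1 - axis j 1 :: real ^ 'n) $ i \<noteq> 0"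
    using assms by (simp add: axis_def)
  then have "(axis i 1 - axis j 1 :: real ^ 'n) \<noteq> 0"
    by (metis zero_index)
  then have "negligible {\<theta> :: real ^ 'n. (axis i 1 - axis j 1) \<bullet> \<theta> = 0}"
    by (intro negligible_hyperplane) simp
  then show ?thesis
    by (simp add: negligible_iff_null_sets inner_diff_left inner_axis')
qed

theorem theorem1p2:
  shows "\<exists>E :: (real ^ 'n) set. E \<in> null_sets lebesgue \<and>
    (\<forall>\<theta>. \<theta> \<notin> E \<longrightarrow> (\<forall>j. \<bar>\<theta> $ j\<bar> > 1) \<longrightarrow>
      (\<forall>(m::nat) (a :: nat \<Rightarrow> real ^ 'n) (p :: nat \<Rightarrow> real).
         m \<ge> 2 \<longrightarrow> affinely_irreducible \<theta> (a ` {1..m}) \<longrightarrow>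
         (\<forall>j\<in>{1..m}. p j > 0) \<longrightarrow> (\<Sum>j=1..m. p j) = 1 \<longrightarrow>
         self_affine_measure \<theta> m a p \<in> power_fourier_decay))"
proof -
  have "\<forall>J\<in>{2::nat..}. \<exists>\<rho> \<delta>. 0 < \<rho> \<and> \<rho> < 1/2 \<and> 0 < \<delta> \<and>
    (\<forall>k. limsup (resonant k (real J) \<rho> \<delta>) \<in> null_sets (lborel :: (real ^ 'n) measure))"
    by (intro ballI limsup_resonant_null) auto
  then obtain \<rho> \<delta> where \<rho>\<delta>: "\<forall>J\<in>{2::nat..}. 0 < \<rho> J \<and> \<rho> J < 1/2 \<and> 0 < \<delta> J \<and>
    (\<forall>k. limsup (resonant k (real J) (\<rho> J) (\<delta> J)) \<in> null_sets (lborel :: (real ^ 'n) measure))"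
    unfolding bchoice_iff by (elim exE) (rule that)
  then have \<rho>: "0 < \<rho> J" "\<rho> J < 1/2" "0 < \<delta> J" if "J \<ge> 2" for J
    using that by auto
  have null: "limsup (resonant k (real J) (\<rho> J) (\<delta> J)) \<in> null_sets (lborel :: (real ^ 'n) measure)"
    if "J \<ge> 2" for J k
    using \<rho>\<delta> that by simp
  define E1 where "E1 = (\<Union>(i, j)\<in>{(i, j). i \<noteq> j}. {\<theta> :: real ^ 'n. \<theta> $ i = \<theta> $ j})"
  define E2 where "E2 = (\<Union>J\<in>{2..}. \<Union>k. limsup (resonant k (real J) (\<rho> J) (\<delta> J)) :: (real ^ 'n) set)"
  have "E1 \<in> null_sets lebesgue"
    unfolding E1_def by (intro null_sets_UN') (auto intro: null_set_coordinates_coincide)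
  moreover have "E2 \<in> null_sets lborel"
    unfolding E2_def using null by (intro null_sets_UN') auto
  then have "E2 \<in> null_sets lebesgue"
    by (rule null_sets_completionI)
  ultimately have "E1 \<union> E2 \<in> null_sets lebesgue"
    by (rule null_sets.Un)
  moreover have "self_affine_measure \<theta> m a p \<in> power_fourier_decay"
    if \<theta>E: "\<theta> \<notin> E1 \<union> E2" and \<theta>: "\<forall>j. \<bar>\<theta> $ j\<bar> > 1" and m: "m \<ge> 2"
      and irr: "affinely_irreducible \<theta> (a ` {1..m})"
      and p: "\<forall>j\<in>{1..m}. p j > 0" "(\<Sum>j=1..m. p j) = 1"
    for \<theta> :: "real ^ 'n" and m a p
  proof -
    have "\<forall>k. \<exists>j. j \<in> {1..m} \<and> a j $ k \<noteq> a 1 $ k"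
      using irreducible_digits_differ[OF \<theta> irr] by blast
    then obtain d where d: "\<And>k. d k \<in> {1..m}" "\<And>k. a (d k) $ k \<noteq> a 1 $ k"
      by metis
    have d2: "d k \<in> {2..m}" for k
    proof -
      have "d k \<noteq> 1" using d(2)[of k] by metis
      then show ?thesis using d(1)[of k] by auto
    qed
    have small: "eventually (\<lambda>J::nat. 1 / real J \<le> c) sequentially" if "c > 0" for c :: real
      using order_tendstoD(2)[OF lim_1_over_n that] by (auto elim: eventually_mono)
    have big: "eventually (\<lambda>J::nat. c \<le> real J) sequentially" for c :: real
      using filterlim_real_sequentially by (simp add: filterlim_at_top)
    have distinct: "\<theta> $ i \<noteq> \<theta> $ k" if "i \<noteq> k" for i k
      using \<theta>E that by (auto simp: E1_def)
    \<comment> \<open>One \<open>J\<close> serves all indices at once because there are finitely many conditions.\<close>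
    have "eventually (\<lambda>J::nat. J \<ge> 2 \<and> (\<forall>i. 1 / real J \<le> \<bar>\<theta> $ i\<bar> - 1) \<and> (\<forall>i. \<bar>\<theta> $ i\<bar> \<le> real J) \<and>
      (\<forall>i k. i \<noteq> k \<longrightarrow> 1 / real J \<le> \<bar>\<theta> $ k - \<theta> $ i\<bar>) \<and>
      (\<forall>k i. \<bar>(a (d k) - a 1) $ i\<bar> \<le> real J) \<and>
      (\<forall>k. 1 / real J \<le> \<bar>(a (d k) - a 1) $ k\<bar> / \<bar>\<theta> $ k\<bar>)) sequentially"
    proof (intro eventually_conj eventually_all_finite eventually_ge_at_top big)
      show "eventually (\<lambda>J::nat. 1 / real J \<le> \<bar>\<theta> $ i\<bar> - 1) sequentially" for i
        using \<theta> by (intro small) simp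
      show "eventually (\<lambda>J::nat. i \<noteq> k \<longrightarrow> 1 / real J \<le> \<bar>\<theta> $ k - \<theta> $ i\<bar>) sequentially" for i k
        using small[of "\<bar>\<theta> $ k - \<theta> $ i\<bar>"] distinct[of i k] by (cases "i = k") auto
      show "eventually (\<lambda>J::nat. 1 / real J \<le> \<bar>(a (d k) - a 1) $ k\<bar> / \<bar>\<theta> $ k\<bar>) sequentially" for k
      proof (rule small)
        have "\<bar>\<theta> $ k\<bar> > 0" using \<theta>[rule_format, of k] by linarith
        then show "\<bar>(a (d k) - a 1) $ k\<bar> / \<bar>\<theta> $ k\<bar> > 0"
          using d(2)[of k] by simp
      qed
    qed
    from eventually_happens'[OF sequentially_bot this]
    obtain J :: nat where J: "J \<ge> 2" "\<forall>i. 1 / real J \<le> \<bar>\<theta> $ i\<bar> - 1" "\<forall>i. \<bar>\<theta> $ i\<bar> \<le> real J"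
      "\<forall>i k. i \<noteq> k \<longrightarrow> 1 / real J \<le> \<bar>\<theta> $ k - \<theta> $ i\<bar>"
      "\<forall>k i. \<bar>(a (d k) - a 1) $ i\<bar> \<le> real J"
      "\<forall>k. 1 / real J \<le> \<bar>(a (d k) - a 1) $ k\<bar> / \<bar>\<theta> $ k\<bar>"
      by (elim exE conjE) (rule that)
    have "eventually (\<lambda>N. \<theta> \<notin> resonant k (real J) (\<rho> J) (\<delta> J) N) sequentially" for k
    proof -
      have "\<theta> \<notin> limsup (resonant k (real J) (\<rho> J) (\<delta> J))"
        using \<theta>E J(1) unfolding E2_def by auto
      then show ?thesis by (simp add: mem_limsup_iff not_frequently)
    qed
    then have "eventually (\<lambda>N. \<forall>k. \<theta> \<notin> resonant k (real J) (\<rho> J) (\<delta> J) N) sequentially"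
      by (rule eventually_all_finite)
    then obtain N0 where N0: "\<And>k N. N \<ge> N0 \<Longrightarrow> \<theta> \<notin> resonant k (real J) (\<rho> J) (\<delta> J) N"
      unfolding eventually_sequentially by blast
    have J': "real J > 1" "1 + 1 / real J \<le> \<bar>\<theta> $ i\<bar>" for i
      using J(1) J(2)[rule_format, of i] by auto
    show ?thesis
      by (rule fourier_decay_if_nonresonant[OF
            is_self_affine_measure_self_affine_measure[OF \<theta> p] \<theta> p J' J(3)[rule_format] J(4)[rule_format] d2 J(5)[rule_format] J(6)[rule_format]
            \<rho>(1)[OF J(1)] \<rho>(2)[OF J(1)] \<rho>(3)[OF J(1)] N0])
  qed
  ultimately show ?thesis by blast
qed

end
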